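(* Let $J=\mathbb{Z}^+$, let $X_1,X_2$ be Hilbert spaces, and let $A_{11}(n)\in\mathcal{L}(X_1)$, $A_{12}(n)\in\mathcal{L}(X_2,X_1)$, $A_{22}(n)\in\mathcal{L}(X_2)$ for $n\in\mathbb{Z}^+$. Suppose that the block triangular system $$x(n+1)=\begin{pmatrix}A_{11}(n)&A_{12}(n)\\0&A_{22}(n)\end{pmatrix}x(n),\quad n\in\mathbb{Z}^+,$$ on $X_1\times X_2$ admits an exponential dichotomy with projections $P(n)$, $n\in\mathbb{Z}^+$, such that $d:=\dim\mathcal{N}P(0)<+\infty$. For $i=1,2$ let $$\mathcal{S}_i=\Big\{v_i\in X_i:\ \sup_{n\in\mathbb{Z}^+}\|\Phi_{ii}(n,0)v_i\|<+\infty\Big\},$$ where $\Phi_{ii}$ is the cocycle of $x_i(n+1)=A_{ii}(n)x_i(n)$, $n\in\mathbb{Z}^+$. Then: (1) $\mathcal{S}_2$ is complemented and closed in $X_2$, $d_2:=\operatorname{codim}\mathcal{S}_2\le d$, and the system $x_2(n+1)=A_{22}(n)x_2(n)$, $n\in\mathbb{Z}^+$, admits an exponential dichotomy; (2) $\mathcal{S}_1$ is closed and complemented in $X_1$; (3) the block diagonal system $$x(n+1)=\begin{pmatrix}A_{11}(n)&0\\0&A_{22}(n)\end{pmatrix}x(n),\quad n\in\mathbb{Z}^+,$$ admits an exponential dichotomy if and only if $d=d_1+d_2$, where $d_1:=\operatorname{codim}\mathcal{S}_1$.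
   Context: $\mathbb{Z}^+$ is the set of nonnegative integers. $\mathcal{L}(X,Y)$ denotes the bounded linear operators $X\to Y$, and $\mathcal{L}(X)=\mathcal{L}(X,X)$. $X_1\times X_2$ carries the norm $\|(x_1,x_2)\|=\max\{\|x_1\|,\|x_2\|\}$ (equivalent to its Hilbert norm). A (not necessarily closed) subspace $S$ of a Banach space $X$ is complemented if there is a closed subspace $Z\subset X$ with $X=S\oplus Z$ (algebraic direct sum). $\operatorname{codim}\mathcal{S}_i$ is the codimension in $X_i$. Exponential dichotomy. Let $X$ be a Banach space and $(A(n))_{n\in\mathbb{Z}^+}\subset\mathcal{L}(X)$. The cocycle of the system $x(n+1)=A(n)x(n)$, $n\in\mathbb{Z}^+$, is $\Phi(m,n)=A(m-1)\cdots A(n)$ for $m>n$ and $\Phi(n,n)=\mathrm{Id}$. The system admits an exponential dichotomy (with projections $P(n)$) if there exist (bounded) projections $(P(n))_{n\in\mathbb{Z}^+}\subset\mathcal{L}(X)$ and constants $K,\alpha>0$ such that: (i) for every $n\in\mathbb{Z}^+$, $A(n)P(n)=P(n+1)A(n)$ and $A(n)|_{\mathcal{N}P(n)}:\mathcal{N}P(n)\to\mathcal{N}P(n+1)$ is invertible, where $\mathcal{N}P(n)$ is the kernel of $P(n)$; (ii) $\|\Phi(m,n)P(n)\|\le Ke^{-\alpha(m-n)}$ for $m\ge n\ge0$; (iii) $\|\Phi(m,n)(\mathrm{Id}-P(n))\|\le Ke^{-\alpha(n-m)}$ for $0\le m\le n$, where for $m\le n$, $\Phi(m,n):=(\Phi(n,m)|_{\mathcal{N}P(m)})^{-1}:\mathcal{N}P(n)\to\mathcal{N}P(m)$.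 *)

theory Defs
  imports "HOL-Analysis.Analysis" "HOL-Library.Extended_Nat"
begin

section \<open>Hilbert spaces over the real or complex field\<close>

text \<open>
  The scalar sort \<open>{real_normed_field, euclidean_space}\<close> is inhabited, up to isometric
  isomorphism, exactly by the reals and the complex numbers, so a statement that is polymorphic
  in \<open>'k\<close> covers both kinds of Hilbert space. For \<open>'k = complex\<close> the real inner product of the
  type class is the real part of the complex one, which polarization recovers from the
  homogeneity of the norm. For \<open>'k = real\<close> the only instance is \<open>scaleR\<close>.
\<close>

locale hilbert_space = vector_space scale
  for scale :: "'k::{real_normed_field, euclidean_space} \<Rightarrow> 'a::{real_inner, complete_space} \<Rightarrow> 'a" +
  assumes scale_of_real: "scale (of_real r) x = r *\<^sub>R x"
    and norm_scale: "norm (scale c x) = norm c * norm x"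

lemma hilbert_space_scaleR:
  "hilbert_space (scaleR :: real \<Rightarrow> 'a::{real_inner, complete_space} \<Rightarrow> 'a)"
  by unfold_locales (auto simp: algebra_simps)

lemma hilbert_space_complex: "hilbert_space ((*) :: complex \<Rightarrow> complex \<Rightarrow> complex)"
  by unfold_locales (auto simp: algebra_simps norm_mult scaleR_conv_of_real)

text \<open>The space \<open>\<L>(X, Y)\<close>.\<close>

definition bounded_operators ::
  "('k::field \<Rightarrow> 'a::real_normed_vector \<Rightarrow> 'a) \<Rightarrow> ('k \<Rightarrow> 'b::real_normed_vector \<Rightarrow> 'b) \<Rightarrow> ('a \<Rightarrow> 'b) set"
  where "bounded_operators s t = {f. Vector_Spaces.linear s t f \<and> bounded_linear f}"

section \<open>Dimension, codimension, complements\<close>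

text \<open>Unlike \<open>dim\<close>, which is \<open>0\<close> on infinite-dimensional spaces.\<close>

definition edim :: "('k::field \<Rightarrow> 'a::ab_group_add \<Rightarrow> 'a) \<Rightarrow> 'a set \<Rightarrow> enat"
  where "edim s V = (if \<exists>B. finite B \<and> V \<subseteq> module.span s B then enat (vector_space.dim s V) else \<infinity>)"

text \<open>
  For a subspace \<open>S\<close>: the projection onto the quotient by \<open>S\<close> is injective on \<open>B\<close> and maps \<open>B\<close>
  onto a basis of the quotient.
\<close>

definition quotient_basis :: "('k::field \<Rightarrow> 'a::ab_group_add \<Rightarrow> 'a) \<Rightarrow> 'a set \<Rightarrow> 'a set \<Rightarrow> bool"
  where "quotient_basis s S B \<longleftrightarrow>
    \<not> module.dependent s B \<and> module.span s B \<inter> S = {0} \<and> module.span s (B \<union> S) = UNIV"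

text \<open>All quotient bases of a subspace are equipotent, so the choice does not matter.\<close>

definition codim :: "('k::field \<Rightarrow> 'a::ab_group_add \<Rightarrow> 'a) \<Rightarrow> 'a set \<Rightarrow> enat"
  where "codim s S = (if \<exists>B. finite B \<and> quotient_basis s S B
                      then enat (card (SOME B. quotient_basis s S B)) else \<infinity>)"

definition complemented :: "('k::field \<Rightarrow> 'a::real_normed_vector \<Rightarrow> 'a) \<Rightarrow> 'a set \<Rightarrow> bool"
  where "complemented s S \<longleftrightarrow> module.subspace s S \<and>
    (\<exists>Z. module.subspace s Z \<and> closed Z \<and> S \<inter> Z = {0} \<and> (\<forall>x. \<exists>u\<in>S. \<exists>z\<in>Z. x = u + z))"

section \<open>Exponential dichotomies\<close>

definition kernel :: "('a \<Rightarrow> 'b::zero) \<Rightarrow> 'a set"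
  where "kernel f = {x. f x = 0}"

text \<open>\<open>cocycle A m n\<close> is \<open>A (m - 1) \<circ> \<dots> \<circ> A n\<close>; it is only meant for \<open>n \<le> m\<close>.\<close>

fun cocycle :: "(nat \<Rightarrow> 'a \<Rightarrow> 'a) \<Rightarrow> nat \<Rightarrow> nat \<Rightarrow> 'a \<Rightarrow> 'a"
  where
    "cocycle A 0 n = id"
  | "cocycle A (Suc m) n = (if n \<le> m then A m \<circ> cocycle A m n else id)"

text \<open>For \<open>m \<le> n\<close>: the inverse of \<open>cocycle A n m\<close> restricted to the kernels of \<open>P m\<close> and \<open>P n\<close>.\<close>

definition backward_cocycle ::
  "(nat \<Rightarrow> 'a \<Rightarrow> 'a) \<Rightarrow> (nat \<Rightarrow> 'a \<Rightarrow> 'a::zero) \<Rightarrow> nat \<Rightarrow> nat \<Rightarrow> 'a \<Rightarrow> 'a"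
  where "backward_cocycle A P m n = inv_into (kernel (P m)) (cocycle A n m)"

text \<open>
  The operator norm bounds are written pointwise. On a product type the norm is the Hilbert norm;
  replacing it by the equivalent maximum norm only changes the constant \<open>K\<close>.
\<close>

definition exp_dichotomy_with ::
  "('k::field \<Rightarrow> 'a::real_normed_vector \<Rightarrow> 'a) \<Rightarrow> (nat \<Rightarrow> 'a \<Rightarrow> 'a) \<Rightarrow> (nat \<Rightarrow> 'a \<Rightarrow> 'a) \<Rightarrow> bool"
  where "exp_dichotomy_with s A P \<longleftrightarrow>
    (\<forall>n. P n \<in> bounded_operators s s \<and> P n \<circ> P n = P n) \<and>
    (\<forall>n. A n \<circ> P n = P (Suc n) \<circ> A n \<and> bij_betw (A n) (kernel (P n)) (kernel (P (Suc n)))) \<and>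
    (\<exists>K>0. \<exists>\<alpha>>0.
       (\<forall>m n x. n \<le> m \<longrightarrow>
          norm (cocycle A m n (P n x)) \<le> K * exp (- \<alpha> * (real m - real n)) * norm x) \<and>
       (\<forall>m n x. m \<le> n \<longrightarrow>
          norm (backward_cocycle A P m n (x - P n x)) \<le> K * exp (- \<alpha> * (real n - real m)) * norm x))"

definition exp_dichotomy ::
  "('k::field \<Rightarrow> 'a::real_normed_vector \<Rightarrow> 'a) \<Rightarrow> (nat \<Rightarrow> 'a \<Rightarrow> 'a) \<Rightarrow> bool"
  where "exp_dichotomy s A \<longleftrightarrow> (\<exists>P. exp_dichotomy_with s A P)"

definition bounded_initial_values :: "(nat \<Rightarrow> 'a \<Rightarrow> 'a::real_normed_vector) \<Rightarrow> 'a set"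
  where "bounded_initial_values A = {v. bdd_above (range (\<lambda>n. norm (cocycle A n 0 v)))}"

section \<open>Block systems\<close>

definition block_triangular ::
  "(nat \<Rightarrow> 'a \<Rightarrow> 'a) \<Rightarrow> (nat \<Rightarrow> 'b \<Rightarrow> 'a::plus) \<Rightarrow> (nat \<Rightarrow> 'b \<Rightarrow> 'b) \<Rightarrow> nat \<Rightarrow> 'a \<times> 'b \<Rightarrow> 'a \<times> 'b"
  where "block_triangular A11 A12 A22 n = (\<lambda>(x1, x2). (A11 n x1 + A12 n x2, A22 n x2))"

definition block_diagonal ::
  "(nat \<Rightarrow> 'a \<Rightarrow> 'a) \<Rightarrow> (nat \<Rightarrow> 'b \<Rightarrow> 'b) \<Rightarrow> nat \<Rightarrow> 'a \<times> 'b \<Rightarrow> 'a \<times> 'b"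
  where "block_diagonal A11 A22 n = (\<lambda>(x1, x2). (A11 n x1, A22 n x2))"

end

theory Submission
  imports Defs
begin

text \<open>
  The unstable directions of the triangular system at time \<open>0\<close> form the finite-dimensional space
  \<open>V = kernel (P 0)\<close>, and \<open>Q = I - P 0\<close> has the bounded initial values as its kernel. Hence
  \<open>S1\<close> is the kernel of \<open>a \<mapsto> Q (a, 0)\<close> and \<open>S2\<close> is the preimage under \<open>b \<mapsto> Q (0, b)\<close> of the
  subspace \<open>W = Q (X\<^sub>1 \<times> S2)\<close>, so both are closed and \<open>d1 = dim R\<close>, \<open>d2 = d - dim W\<close>,
  where \<open>R = Q (X\<^sub>1 \<times> 0) \<subseteq> W\<close>. Thus \<open>d = d1 + d2\<close> says that every vector of \<open>S2\<close> is the second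
  component of a bounded initial value of the triangular system.

  Dichotomies are produced by Perron's theorem: a complemented space of bounded initial values and
  a bounded solution for every bounded perturbation suffice. Admissibility passes from the
  triangular system to its quotient \<open>A22\<close>, and to \<open>A11\<close> as soon as the vectors of \<open>S2\<close> lift.
\<close>

section \<open>Closed graphs and finite-dimensional subspaces\<close>

text \<open>The kernels of \<open>P n\<close> are not determined by the system and need not respect
  the two factors, so the diagonal blocks of \<open>P n\<close> are in general not projections and
  cannot serve as a dichotomy of \<open>A22\<close>. Nor is there a bound on \<open>A12 n\<close>
  uniform in \<open>n\<close>, so coupling terms cannot be summed and estimated. Both obstacles
  disappear when one speaks only of solvability in bounded sequences, which mentions no projection:
  a perturbation of one factor is solved in the product, and the coupling is never estimated but
  cancelled by subtracting a bounded orbit with the same second component. The uniform constants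
  lost in this way are recovered by the closed graph theorem for the solution operator; testing that
  operator on impulses gives the projections, testing it on finite time windows gives the
  exponential rate. In the converse direction the diagonal dichotomy only yields lifts up to an
  error tending to zero; finite dimension makes \<open>R\<close> closed and so turns them into an
  exact lift.\<close>

lemma geometric_sums_complete:
  fixes f :: "nat \<Rightarrow> 'a::real_normed_vector"
  assumes complete: "complete (UNIV :: 'a set)"
    and r: "0 \<le> r" "r < 1" and f: "\<And>i. norm (f i) \<le> C * r ^ i"
  obtains l where "f sums l" "norm l \<le> C / (1 - r)"
proof -
  define s where "s n = (\<Sum>i<n. f i)" for n
  define t where "t n = (\<Sum>i<n. C * r ^ i)" for n
  have t: "t \<longlonglongrightarrow> C * (1 / (1 - r))"
    using sums_mult[OF geometric_sums, of r C] r by (simp add: sums_def t_def[abs_def])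
  have le: "norm (s m - s n) \<le> norm (t m - t n)" if "n \<le> m" for m n
  proof -
    have "s m - s n = (\<Sum>i\<in>{n..<m}. f i)"
      using that by (simp add: s_def sum_diff_nat_ivl lessThan_atLeast0)
    also have "norm \<dots> \<le> (\<Sum>i\<in>{n..<m}. C * r ^ i)"
      by (rule sum_norm_le) (use f in auto)
    also have "\<dots> = t m - t n"
      using that by (simp add: t_def sum_diff_nat_ivl lessThan_atLeast0)
    finally show ?thesis by simp
  qed
  have le': "norm (s m - s n) \<le> norm (t m - t n)" for m n
    using le[of m n] le[of n m] by (cases "n \<le> m") (auto simp: norm_minus_commute)
  have "Cauchy t"
    using t by (rule LIMSEQ_imp_Cauchy)
  then have "Cauchy s"
    unfolding Cauchy_iff using le' by (meson order_le_less_trans)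
  then obtain l where l: "s \<longlonglongrightarrow> l"
    using complete by (auto simp: complete_def)
  have "(\<lambda>n. norm (s n)) \<longlonglongrightarrow> norm l"
    using l by (rule tendsto_norm)
  moreover have "norm (s n) \<le> C / (1 - r)" for n
  proof -
    have C: "0 \<le> C"
      using order_trans[OF norm_ge_zero f[of 0]] by simp
    have "norm (s n) \<le> t n"
      unfolding s_def t_def by (rule sum_norm_le) (use f in auto)
    also have "t n \<le> C * (1 / (1 - r))"
    proof (rule LIMSEQ_le_const[OF t], intro exI allI impI)
      show "t n \<le> t m" if "n \<le> m" for m
        unfolding t_def by (rule sum_mono2) (use that C r in auto)
    qed
    finally show ?thesis by simp
  qed
  ultimately have "norm l \<le> C / (1 - r)"
    by (meson LIMSEQ_le_const2)
  then show thesis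
    using that[of l] l unfolding sums_def s_def[abs_def] by blast
qed

text \<open>By Baire, the closure of some set on which \<open>norm (f x)\<close> is at most
  \<open>k\<close> contains a ball. Approximation from that set, iterated on the remainders, writes
  \<open>x\<close> as a series whose image series converges, and the graph condition identifies the
  sum with \<open>f x\<close>. Completeness is a hypothesis on \<open>UNIV\<close> because the sort
  \<open>{real_inner, complete_space}\<close> is not below \<open>banach\<close>.\<close>

theorem closed_graph_bounded:
  fixes f :: "'a::real_normed_vector \<Rightarrow> 'b::real_normed_vector"
  assumes complete: "complete (UNIV :: 'a set)" "complete (UNIV :: 'b set)"
    and lin: "linear f"
    and graph: "\<And>u x y. u \<longlonglongrightarrow> x \<Longrightarrow> (\<lambda>n. f (u n)) \<longlonglongrightarrow> y \<Longrightarrow> f x = y"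
  shows "\<exists>C>0. \<forall>x. norm (f x) \<le> C * norm x"
proof -
  interpret linear f by (rule lin)
  define A where "A k = closure {x. norm (f x) \<le> real k}" for k :: nat
  have "\<exists>k. interior (A k) \<noteq> {}"
  proof (rule ccontr)
    assume no: "\<not> ?thesis"
    have "Met_TC.mtopology interior_of \<Union>(range A) = {}"
    proof (rule Met_TC.metric_Baire_category_alt)
      show "Met_TC.mcomplete TYPE('a)"
        using complete(1) by (auto simp: Met_TC.mcomplete_def complete_def)
    qed (use no in \<open>auto simp: A_def\<close>)
    moreover have "\<Union>(range A) = UNIV"
    proof -
      have "x \<in> A (nat \<lceil>norm (f x)\<rceil>)" for x
        unfolding A_def by (rule subsetD[OF closure_subset]) (simp add: of_nat_ceiling)
      then show ?thesis by blast
    qed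
    ultimately show False by simp
  qed
  then obtain k x0 r where r: "r > 0" and ball: "ball x0 r \<subseteq> A k"
    by (metis all_not_in_conv mem_interior)
  \<comment> \<open>Half the difference of approximants of \<open>x0 + x\<close> and
    \<open>x0 - x\<close> approximates \<open>x\<close>: the centre \<open>x0\<close> cancels and
    the bound \<open>k\<close> survives.\<close>
  have appr: "\<exists>a. norm (f a) \<le> k \<and> norm (x - a) < e" if x: "norm x < r" and e: "e > 0" for x e
  proof -
    have "x0 + x \<in> A k" "x0 - x \<in> A k"
      using ball x by (auto simp: dist_norm subset_iff)
    then obtain a b where a: "norm (f a) \<le> k" "dist a (x0 + x) < e"
      and b: "norm (f b) \<le> k" "dist b (x0 - x) < e"
      using e unfolding A_def closure_approachable by blast
    have "f ((1/2) *\<^sub>R (a - b)) = (1/2) *\<^sub>R (f a - f b)"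
      by (simp add: scale diff)
    moreover have "norm (f a - f b) \<le> 2 * k"
      using norm_triangle_ineq4[of "f a" "f b"] a b by simp
    moreover have "x - (1/2) *\<^sub>R (a - b) = (1/2) *\<^sub>R ((b - (x0 - x)) - (a - (x0 + x)))"
      by (simp add: algebra_simps flip: scaleR_add_left)
    moreover have "norm ((b - (x0 - x)) - (a - (x0 + x))) < 2 * e"
      using norm_triangle_ineq4[of "b - (x0 - x)" "a - (x0 + x)"] a b by (simp add: dist_norm)
    ultimately have "norm (f ((1/2) *\<^sub>R (a - b))) \<le> k \<and> norm (x - (1/2) *\<^sub>R (a - b)) < e"
      by (simp only: norm_scaleR) simp
    then show ?thesis by blast
  qed
  \<comment> \<open>Rescaling \<open>x\<close> to norm \<open>r / 2\<close> and approximating within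
    \<open>r / 4\<close> halves the remainder; undoing the scaling turns \<open>k\<close> into
    \<open>D * norm x\<close>.\<close>
  define D where "D = 2 * k / r"
  have "\<exists>a. norm (f a) \<le> D * norm x \<and> norm (x - a) \<le> norm x / 2" for x
  proof (cases "x = 0")
    case False
    define t where "t = r / (2 * norm x)"
    have t: "t > 0" "t * norm x = r / 2"
      using False r by (auto simp: t_def)
    then obtain a where a: "norm (f a) \<le> k" "norm (t *\<^sub>R x - a) < r / 4"
      using appr[of "t *\<^sub>R x" "r / 4"] r by auto
    have "norm (f ((1 / t) *\<^sub>R a)) \<le> D * norm x"
    proof -
      have "norm (f ((1 / t) *\<^sub>R a)) = norm (f a) / t"
        using t by (simp add: scale)
      also have "\<dots> \<le> k / t"
        using a t by (simp add: divide_right_mono)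
      also have "\<dots> = D * norm x"
        using r False by (simp add: t_def D_def field_simps)
      finally show ?thesis .
    qed
    moreover have "norm (x - (1 / t) *\<^sub>R a) \<le> norm x / 2"
    proof -
      have "x - (1 / t) *\<^sub>R a = (1 / t) *\<^sub>R (t *\<^sub>R x - a)"
        using t by (simp add: algebra_simps)
      then have "norm (x - (1 / t) *\<^sub>R a) = norm (t *\<^sub>R x - a) / t"
        using t by simp
      also have "\<dots> \<le> (r / 4) / t"
        using a t by (intro divide_right_mono) auto
      also have "\<dots> = norm x / 2"
        using r False by (simp add: t_def field_simps)
      finally show ?thesis .
    qed
    ultimately show ?thesis by blast
  qed (auto simp: zero intro: exI[of _ 0])
  then obtain g where g: "\<And>x. norm (f (g x)) \<le> D * norm x" "\<And>x. norm (x - g x) \<le> norm x / 2"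
    by metis
  have D: "D \<ge> 0"
    using r by (simp add: D_def)
  \<comment> \<open>The geometric series with ratio 1/2 contributes \<open>2 * D\<close>; the added
    1 keeps the constant positive when \<open>D = 0\<close>.\<close>
  have "norm (f x) \<le> (2 * D + 1) * norm x" for x
  proof -
    \<comment> \<open>\<open>e n\<close> is the remainder after \<open>n\<close> rounds of
      approximation, so the approximants \<open>g (e i)\<close> telescope to
      \<open>x\<close>.\<close>
    define e where "e n = ((\<lambda>y. y - g y) ^^ n) x" for n
    have e_Suc: "e (Suc n) = e n - g (e n)" for n
      by (simp add: e_def)
    have e_le: "norm (e n) \<le> norm x * (1 / 2) ^ n" for n
    proof (induction n)
      case (Suc n)
      then show ?case using g(2)[of "e n"] by (simp add: e_Suc)
    qed (simp add: e_def)
    have sum_g: "(\<Sum>i<n. g (e i)) = x - e n" for n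
      by (induction n) (auto simp: e_Suc, simp add: e_def)
    have "(\<lambda>n. norm x * (1 / 2) ^ n) \<longlonglongrightarrow> 0"
      by (intro tendsto_mult_right_zero LIMSEQ_power_zero) simp
    then have "e \<longlonglongrightarrow> 0"
      by (rule Lim_null_comparison[rotated]) (simp add: e_le)
    then have lim: "(\<lambda>n. \<Sum>i<n. g (e i)) \<longlonglongrightarrow> x"
      unfolding sum_g using tendsto_diff[OF tendsto_const, of e 0 _ x] by simp
    obtain l where l: "(\<lambda>i. f (g (e i))) sums l" "norm l \<le> (D * norm x) / (1 - 1 / 2)"
    proof (rule geometric_sums_complete[OF complete(2)])
      show "norm (f (g (e i))) \<le> D * norm x * (1 / 2) ^ i" for i
        using order_trans[OF g(1) mult_left_mono[OF e_le D]] by (simp add: mult.assoc)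
    qed (use that in simp_all)
    have "f x = l"
      using l(1) by (intro graph[OF lim]) (simp add: sums_def sum)
    then show ?thesis
      using l(2) norm_ge_zero[of x] by (simp add: algebra_simps del: norm_ge_zero)
  qed
  then show ?thesis
    using D by (intro exI[of _ "2 * D + 1"]) auto
qed

lemma complete_bcontfun_nat: "complete (UNIV :: (nat \<Rightarrow>\<^sub>C 'a::complete_space) set)"
  unfolding complete_def
proof (intro allI impI, elim conjE)
  fix f :: "nat \<Rightarrow> nat \<Rightarrow>\<^sub>C 'a"
  assume "Cauchy f"
  then obtain g where "uniform_limit UNIV (\<lambda>n. apply_bcontfun (f n)) g sequentially"
    using uniformly_convergent_eq_cauchy[of "\<lambda>_. True" "\<lambda>n. apply_bcontfun (f n)"]
    unfolding Cauchy_def uniform_limit_sequentially_iff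
    by (metis dist_fun_lt_imp_dist_val_lt)
  from uniform_limit_bcontfunE[OF this sequentially_bot]
  show "\<exists>l\<in>UNIV. f \<longlonglongrightarrow> l"
    by (metis UNIV_I)
qed

section \<open>Closedness of finite-dimensional subspaces over the field of scalars\<close>

context hilbert_space
begin

lemma tendsto_scale_left: "(\<lambda>n. scale (c n) x) \<longlonglongrightarrow> scale b x" if "c \<longlonglongrightarrow> b"
proof -
  have "(\<lambda>n. norm (c n - b) * norm x) \<longlonglongrightarrow> norm (b - b) * norm x"
    by (intro tendsto_intros that)
  then have "(\<lambda>n. norm (scale (c n) x - scale b x)) \<longlonglongrightarrow> 0"
    by (simp add: norm_scale flip: scale_left_diff_distrib)
  then show ?thesis
    by (rule LIM_zero_cancel[OF tendsto_norm_zero_cancel])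
qed

text \<open>A vector outside the closed \<open>M\<close> has positive distance \<delta> to it, so
  the coefficient of \<open>x\<close> is controlled by the norm of the whole vector. The
  coefficients of a convergent sequence are therefore Cauchy and converge in the complete scalar
  field.\<close>

lemma closed_span_insert:
  assumes M: "subspace M" "closed M"
  shows "closed (span (insert x M))"
proof (cases "x \<in> M")
  case True
  then show ?thesis
    using M by (simp add: insert_absorb span_eq_iff[THEN iffD2])
next
  case False
  have span_M: "span M = M"
    using M by (simp add: span_eq_iff)
  obtain \<delta> where \<delta>: "\<delta> > 0" "\<And>m. m \<in> M \<Longrightarrow> \<delta> \<le> dist m x"
    using False M closed_approachable[of M x] by (meson not_less)
  have far: "norm c * \<delta> \<le> norm (scale c x + m)" if m: "m \<in> M" for c m
  proof (cases "c = 0")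
    case False
    have "- scale (inverse c) m \<in> M"
      using M m by (simp add: subspace_neg subspace_scale)
    then have "\<delta> \<le> norm (x + scale (inverse c) m)"
      using \<delta>(2) by (fastforce simp: dist_norm norm_minus_commute)
    then have "norm c * \<delta> \<le> norm (scale c (x + scale (inverse c) m))"
      by (simp add: norm_scale mult_left_mono)
    then show ?thesis
      using False by (simp add: scale_right_distrib)
  qed simp
  show ?thesis
    unfolding closed_sequential_limits
  proof (intro allI impI, elim conjE)
    fix u l assume u: "\<forall>n. u n \<in> span (insert x M)" and lim: "u \<longlonglongrightarrow> l"
    then obtain c where c: "\<And>n. u n - scale (c n) x \<in> M"
      unfolding span_breakdown_eq span_M by metis
    have c_le: "norm (c m - c n) * \<delta> \<le> norm (u m - u n)" for m n
    proof -
      have "(u m - scale (c m) x) - (u n - scale (c n) x) \<in> M"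
        by (intro subspace_diff M c)
      from far[OF this, of "c m - c n"] show ?thesis
        by (simp add: algebra_simps)
    qed
    have "Cauchy c"
    proof (rule CauchyI)
      fix e :: real assume "e > 0"
      then obtain N where N: "\<And>m n. m \<ge> N \<Longrightarrow> n \<ge> N \<Longrightarrow> norm (u m - u n) < e * \<delta>"
        using LIMSEQ_imp_Cauchy[OF lim] \<delta> by (meson CauchyD mult_pos_pos)
      have "norm (c m - c n) < e" if "m \<ge> N" "n \<ge> N" for m n
        using order_le_less_trans[OF c_le N[OF that]] \<delta> by simp
      then show "\<exists>N. \<forall>m\<ge>N. \<forall>n\<ge>N. norm (c m - c n) < e" by blast
    qed
    then obtain b where b: "c \<longlonglongrightarrow> b"
      using Cauchy_convergent convergent_def by blast
    have "(\<lambda>n. u n - scale (c n) x) \<longlonglongrightarrow> l - scale b x"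
      by (intro tendsto_diff lim tendsto_scale_left b)
    then have "l - scale b x \<in> M"
      by (rule closed_sequentially[OF M(2) c])
    then show "l \<in> span (insert x M)"
      unfolding span_breakdown_eq span_M by blast
  qed
qed

lemma closed_span_finite: "finite B \<Longrightarrow> closed (span B)"
proof (induction B rule: finite_induct)
  case (insert x B)
  have "span (insert x (span B)) = span (insert x B)"
    by (intro set_eqI) (simp only: span_breakdown_eq span_span)
  then show ?case
    using closed_span_insert[OF subspace_span insert.IH, of x] by metis
qed (simp only: span_empty closed_singleton)

lemma closed_subspace_finite_dim:
  assumes W: "subspace W" "W \<subseteq> span F" and F: "finite F"
  shows "closed W"
proof -
  obtain B where B: "B \<subseteq> W" "independent B" "W \<subseteq> span B"
    by (rule maximal_independent_subset)
  then have "finite B"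
    using independent_span_bound[OF F] W by blast
  moreover have "W = span B"
    using span_minimal[OF B(1) W(1)] B(3) by (rule subset_antisym[rotated])
  ultimately show ?thesis
    using closed_span_finite by (simp only:)
qed

end

section \<open>Codimension of kernels\<close>

text \<open>This models the quotient of \<open>V\<close> by \<open>W\<close> inside the same space:
  a basis of \<open>W\<close> is extended to one of \<open>V\<close>, its vectors are sent to 0 and
  the added ones are fixed. The map is purely algebraic and carries no continuity.\<close>

lemma (in vector_space) linear_collapse_subspace:
  assumes W: "subspace W" "W \<subseteq> V" and V: "subspace V" "V \<subseteq> span F" and F: "finite F"
  obtains h where "Vector_Spaces.linear scale scale h"
    "\<And>v. v \<in> V \<Longrightarrow> h v = 0 \<longleftrightarrow> v \<in> W" "dim (h ` V) + dim W = dim V"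
proof -
  interpret pair: vector_space_pair scale scale by unfold_locales
  obtain B where B: "B \<subseteq> W" "independent B" "W \<subseteq> span B"
    by (rule maximal_independent_subset)
  obtain C where C: "B \<subseteq> C" "C \<subseteq> V" "independent C" "V \<subseteq> span C"
    using maximal_independent_subset_extend[of B V] B W by blast
  have fin: "finite C"
    using independent_span_bound[OF F C(3)] C V by blast
  have W_eq: "W = span B"
    using span_minimal[OF B(1) W(1)] B(3) by blast
  have V_eq: "V = span C"
    using span_minimal[OF C(2) V(1)] C(4) by blast
  define h where "h = pair.construct C (\<lambda>b. if b \<in> B then 0 else b)"
  have lin: "Vector_Spaces.linear scale scale h"
    unfolding h_def by (rule pair.linear_construct[OF C(3)])
  interpret h: Vector_Spaces.linear scale scale h by (rule lin)
  have h_B: "h b = 0" if "b \<in> B" for b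
    using that C pair.construct_basis[OF C(3), of b] by (auto simp: h_def)
  have h_C: "h b = b" if "b \<in> C - B" for b
    using that pair.construct_basis[OF C(3), of b] by (auto simp: h_def)
  have h_W: "h w = 0" if "w \<in> span B" for w
    using h.eq_0_on_span[of B w] h_B that by blast
  have h_span: "h w = w" if "w \<in> span (C - B)" for w
    using pair.linear_eq_on[OF lin linear_ident that] h_C by blast
  have split: "\<exists>u w. u \<in> span B \<and> w \<in> span (C - B) \<and> v = u + w" if "v \<in> V" for v
  proof -
    have "v \<in> span (B \<union> (C - B))"
      using that C(1) by (simp add: V_eq Un_absorb1)
    then show ?thesis
      unfolding span_Un by blast
  qed
  have img: "h ` V = span (C - B)"
  proof
    show "h ` V \<subseteq> span (C - B)"
    proof
      fix y assume "y \<in> h ` V"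
      then obtain u w where "y = h (u + w)" "u \<in> span B" "w \<in> span (C - B)"
        using split by blast
      then show "y \<in> span (C - B)"
        by (simp add: h.add h_W h_span)
    qed
    have "span (C - B) \<subseteq> V"
      unfolding V_eq by (rule span_mono) blast
    then show "span (C - B) \<subseteq> h ` V"
      using h_span by (metis image_eqI subset_iff)
  qed
  have "independent (C - B)"
    using C(3) by (rule independent_mono) blast
  then have "dim (h ` V) + dim W = card (C - B) + card B"
    unfolding img W_eq using B(2) dim_span_eq_card_independent by metis
  also have "\<dots> = card C"
    using C(1) fin by (metis add.commute card_Diff_subset card_mono finite_subset le_add_diff_inverse)
  also have "\<dots> = dim V"
    unfolding V_eq using C(3) dim_span_eq_card_independent by metis
  finally have dim: "dim (h ` V) + dim W = dim V" .
  have "h v = 0 \<longleftrightarrow> v \<in> W" if v: "v \<in> V" for v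
  proof
    obtain u w where uw: "u \<in> span B" "w \<in> span (C - B)" "v = u + w"
      using split[OF v] by blast
    assume "h v = 0"
    then have "w = 0"
      using uw by (simp add: h.add h_W h_span)
    then show "v \<in> W"
      using uw by (simp add: W_eq)
  qed (simp add: W_eq h_W)
  then show thesis
    using that lin dim by blast
qed

context vector_space_pair
begin

text \<open>A finite basis of the range is lifted through a right inverse \<open>g\<close>; every
  \<open>x\<close> splits as \<open>g (f x)\<close> plus the kernel vector
  \<open>x - g (f x)\<close>.\<close>

lemma ex_quotient_basis_kernel:
  assumes f: "Vector_Spaces.linear s1 s2 f" and fin: "range f \<subseteq> vs2.span F" "finite F"
  shows "\<exists>B. finite B \<and> quotient_basis s1 {x. f x = 0} B"
proof -
  interpret f: Vector_Spaces.linear s1 s2 f by (rule f)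
  interpret flip: vector_space_pair s2 s1 by unfold_locales
  obtain C where C: "C \<subseteq> range f" "vs2.independent C" "range f \<subseteq> vs2.span C"
    by (rule vs2.maximal_independent_subset)
  have "finite C"
    using vs2.independent_span_bound[OF fin(2) C(2)] C fin by blast
  have range_eq: "range f = vs2.span C"
    using vs2.span_minimal[OF C(1) f.subspace_image[OF vs1.subspace_UNIV]] C(3) by blast
  obtain g where g: "Vector_Spaces.linear s2 s1 g" "\<And>v. v \<in> range f \<Longrightarrow> f (g v) = v"
    using linear_exists_right_inverse_on[OF f vs1.subspace_UNIV] by blast
  interpret g: Vector_Spaces.linear s2 s1 g by (rule g)
  have "inj_on g (vs2.span C)"
    using g(2) by (metis inj_onI range_eq)
  then have "vs1.independent (g ` C)"
    by (rule g.independent_injective_image[OF C(2)])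
  moreover have "x = 0" if x: "x \<in> vs1.span (g ` C)" "f x = 0" for x
  proof -
    obtain v where v: "v \<in> vs2.span C" "x = g v"
      using x(1) unfolding g.span_image by blast
    then show ?thesis
      using x(2) g(2)[of v] range_eq g.zero by simp
  qed
  moreover have "x \<in> vs1.span (g ` C \<union> {x. f x = 0})" for x
  proof -
    have "g (f x) \<in> vs1.span (g ` C)"
      unfolding g.span_image using range_eq by blast
    then have "g (f x) \<in> vs1.span (g ` C \<union> {x. f x = 0})"
      by (rule subsetD[OF vs1.span_mono, rotated]) blast
    moreover have "x - g (f x) \<in> vs1.span (g ` C \<union> {x. f x = 0})"
      by (rule vs1.span_base) (simp add: f.diff g(2))
    ultimately have "g (f x) + (x - g (f x)) \<in> vs1.span (g ` C \<union> {x. f x = 0})"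
      by (rule vs1.span_add)
    then show ?thesis by simp
  qed
  ultimately have "quotient_basis s1 {x. f x = 0} (g ` C)"
    unfolding quotient_basis_def using vs1.span_zero f.zero by blast
  then show ?thesis
    using \<open>finite C\<close> by blast
qed

text \<open>\<open>f\<close> carries any quotient basis of its kernel injectively onto a basis of
  its range. Since \<open>B\<close> is arbitrary, this applies to the one selected by
  \<open>SOME\<close> in \<open>codim\<close>.\<close>

lemma card_quotient_basis_kernel:
  assumes f: "Vector_Spaces.linear s1 s2 f" and B: "quotient_basis s1 {x. f x = 0} B"
  shows "card B = vs2.dim (range f)"
proof -
  interpret f: Vector_Spaces.linear s1 s2 f by (rule f)
  have B: "vs1.independent B" "vs1.span B \<inter> {x. f x = 0} = {0}" "vs1.span (B \<union> {x. f x = 0}) = UNIV"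
    using B by (auto simp: quotient_basis_def)
  have inj: "inj_on f (vs1.span B)"
    using B(2) by (subst f.inj_on_iff_eq_0) (auto simp: vs1.subspace_span)
  have "vs2.independent (f ` B)"
    by (rule f.independent_injective_image[OF B(1) inj])
  moreover have "range f = vs2.span (f ` B)"
  proof -
    have "range f = vs2.span (f ` B \<union> f ` {x. f x = 0})"
      using B(3) by (metis f.span_image image_Un)
    also have "\<dots> = vs2.span (f ` B)"
    proof -
      have "f ` {x. f x = 0} \<subseteq> {0}" by blast
      then have "f ` B \<union> f ` {x. f x = 0} \<subseteq> vs2.span (f ` B)"
        by (auto intro: vs2.span_base vs2.span_zero)
      then have "vs2.span (f ` B \<union> f ` {x. f x = 0}) \<subseteq> vs2.span (f ` B)"
        by (rule vs2.span_minimal[OF _ vs2.subspace_span])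
      then show ?thesis
        by (rule subset_antisym[OF _ vs2.span_mono[OF Un_upper1]])
    qed
    finally show ?thesis .
  qed
  ultimately have "vs2.dim (range f) = card (f ` B)"
    using vs2.dim_span_eq_card_independent by metis
  also have "\<dots> = card B"
    using inj vs1.span_superset by (intro card_image) (blast intro: inj_on_subset)
  finally show ?thesis by simp
qed

lemma codim_kernel:
  assumes f: "Vector_Spaces.linear s1 s2 f" and fin: "range f \<subseteq> vs2.span F" "finite F"
  shows "codim s1 {x. f x = 0} = enat (vs2.dim (range f))"
proof -
  have ex: "\<exists>B. finite B \<and> quotient_basis s1 {x. f x = 0} B"
    by (rule ex_quotient_basis_kernel[OF f fin])
  then have "quotient_basis s1 {x. f x = 0} (SOME B. quotient_basis s1 {x. f x = 0} B)"
    by (metis someI_ex)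
  then show ?thesis
    unfolding codim_def using ex card_quotient_basis_kernel[OF f] by simp
qed

end

text \<open>The span of a finite quotient basis is a complement, and it is closed by finite
  dimension. \<open>f\<close> is merely linear here, because it will be instantiated with a
  composite that involves the algebraic collapse of a subspace.\<close>

lemma complemented_kernel:
  fixes f :: "'a::{real_inner, complete_space} \<Rightarrow> 'b::{real_inner, complete_space}"
  assumes s: "hilbert_space s" and t: "hilbert_space t"
    and f: "Vector_Spaces.linear s t f" and fin: "range f \<subseteq> module.span t F" "finite F"
  shows "complemented s {x. f x = 0}"
proof -
  interpret s: hilbert_space s by (rule s)
  interpret t: hilbert_space t by (rule t)
  interpret f: Vector_Spaces.linear s t f by (rule f)
  interpret pair: vector_space_pair s t by unfold_locales
  obtain B where B: "finite B" "quotient_basis s {x. f x = 0} B"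
    using pair.ex_quotient_basis_kernel[OF f fin] by blast
  have sub: "s.subspace {x. f x = 0}"
    by (rule f.subspace_kernel)
  have span_ker: "s.span {x. f x = 0} = {x. f x = 0}"
    using sub by (simp add: s.span_eq_iff)
  have "\<exists>u\<in>{x. f x = 0}. \<exists>z\<in>s.span B. x = u + z" for x
  proof -
    have "x \<in> s.span (B \<union> {x. f x = 0})"
      using B(2) unfolding quotient_basis_def by blast
    then obtain z u where "z \<in> s.span B" "u \<in> s.span {x. f x = 0}" "x = z + u"
      unfolding s.span_Un by blast
    then show ?thesis
      unfolding span_ker by (metis add.commute)
  qed
  moreover have "{x. f x = 0} \<inter> s.span B = {0}"
    using B(2) unfolding quotient_basis_def by blast
  ultimately show ?thesis
    unfolding complemented_def using sub s.subspace_span s.closed_span_finite[OF B(1)] by blast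
qed

lemma hilbert_space_prod:
  fixes s :: "'k::{real_normed_field, euclidean_space} \<Rightarrow> 'a::{real_inner, complete_space} \<Rightarrow> 'a"
    and t :: "'k \<Rightarrow> 'b::{real_inner, complete_space} \<Rightarrow> 'b"
  assumes s: "hilbert_space s" and t: "hilbert_space t"
  shows "hilbert_space (module_prod.scale s t)"
proof -
  interpret s: hilbert_space s by (rule s)
  interpret t: hilbert_space t by (rule t)
  interpret st: vector_space_prod s t by unfold_locales
  show ?thesis
  proof
    show "norm (st.scale c x) = norm c * norm x" for c x
    proof (cases x)
      case (Pair a b)
      have "(norm c * norm a)\<^sup>2 + (norm c * norm b)\<^sup>2 = (norm c)\<^sup>2 * ((norm a)\<^sup>2 + (norm b)\<^sup>2)"
        by (simp add: algebra_simps power_mult_distrib)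
      then show ?thesis
        by (simp add: Pair st.scale_prod norm_Pair s.norm_scale t.norm_scale real_sqrt_mult)
    qed
  qed (auto simp: st.scale_def s.scale_of_real t.scale_of_real scaleR_prod_def)
qed

section \<open>Perron's theorem\<close>

lemma cocycle_same [simp]: "cocycle A n n = id"
  by (cases n) auto

lemma cocycle_Suc: "n \<le> m \<Longrightarrow> cocycle A (Suc m) n x = A m (cocycle A m n x)"
  by simp

declare cocycle.simps(2) [simp del]

lemma cocycle_cocycle:
  assumes "k \<le> n" "n \<le> m"
  shows "cocycle A m n (cocycle A n k x) = cocycle A m k x"
  using assms(2)
proof (induction m rule: dec_induct)
  case (step m)
  then show ?case using assms(1) by (simp add: cocycle_Suc)
qed simp

lemma cocycle_unique:
  assumes "n \<le> m" "\<And>k. n \<le> k \<Longrightarrow> k < m \<Longrightarrow> x (Suc k) = A k (x k)"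
  shows "x m = cocycle A m n (x n)"
  using assms
proof (induction m rule: dec_induct)
  case (step m)
  then show ?case by (simp add: cocycle_Suc)
qed simp

lemma cocycle_bounded_operator:
  fixes A :: "nat \<Rightarrow> 'a::real_normed_vector \<Rightarrow> 'a"
  assumes "vector_space s" "\<And>n. A n \<in> bounded_operators s s"
  shows "cocycle A m n \<in> bounded_operators s s"
proof (induction m)
  interpret vector_space s by fact
  case 0
  then show ?case
    using linear_id bounded_linear_ident by (simp add: bounded_operators_def id_def)
next
  interpret vector_space s by fact
  case (Suc m)
  have "bounded_linear (\<lambda>x. A m (cocycle A m n x))"
    using Suc assms(2)[of m] bounded_linear_compose by (auto simp: bounded_operators_def)
  moreover have "Vector_Spaces.linear s s (A m \<circ> cocycle A m n)"
    using Suc assms(2)[of m] Vector_Spaces.linear_compose by (auto simp: bounded_operators_def)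
  ultimately show ?case
    using linear_id bounded_linear_ident
    by (simp add: bounded_operators_def id_def o_def cocycle.simps(2))
qed

text \<open>The stable space at time \<open>n\<close>: for a dichotomy it has to be the range of the
  projection, and below the projections are built onto it.\<close>

definition bounded_orbits :: "(nat \<Rightarrow> 'a \<Rightarrow> 'a::real_normed_vector) \<Rightarrow> nat \<Rightarrow> 'a set"
  where "bounded_orbits A n = {v. \<exists>M. \<forall>m\<ge>n. norm (cocycle A m n v) \<le> M}"

lemma bounded_initial_values_eq: "bounded_initial_values A = bounded_orbits A 0"
  by (auto simp: bounded_initial_values_def bounded_orbits_def bdd_above_def)

text \<open>Boundedness of an orbit is a property of its tail. The direction back from time
  \<open>m\<close> to time \<open>n\<close> gives injectivity on the kernels and, later, lifts at
  time 0.\<close>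

lemma bounded_orbits_cocycle_iff:
  assumes "n \<le> m"
  shows "cocycle A m n v \<in> bounded_orbits A m \<longleftrightarrow> v \<in> bounded_orbits A n"
proof
  assume "v \<in> bounded_orbits A n"
  then obtain M where "\<forall>k\<ge>n. norm (cocycle A k n v) \<le> M"
    unfolding bounded_orbits_def by blast
  then show "cocycle A m n v \<in> bounded_orbits A m"
    unfolding bounded_orbits_def using assms by (auto simp: cocycle_cocycle intro!: exI[of _ M])
next
  assume "cocycle A m n v \<in> bounded_orbits A m"
  then obtain M where M: "\<And>k. k \<ge> m \<Longrightarrow> norm (cocycle A k n v) \<le> M"
    unfolding bounded_orbits_def using assms by (auto simp: cocycle_cocycle)
  \<comment> \<open>Only finitely many times precede \<open>m\<close>, and a sum of norms dominates
    each of its terms.\<close>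
  define M' where "M' = (\<Sum>k<m. norm (cocycle A k n v))"
  have "norm (cocycle A k n v) \<le> max M M'" for k
  proof (cases "k < m")
    case True
    then have "norm (cocycle A k n v) \<le> M'"
      unfolding M'_def by (intro member_le_sum[where f="\<lambda>k. norm (cocycle A k n v)"]) auto
    then show ?thesis by simp
  qed (use M[of k] in auto)
  then show "v \<in> bounded_orbits A n"
    unfolding bounded_orbits_def by blast
qed

lemma subspace_bounded_orbits_of_operators:
  fixes A :: "nat \<Rightarrow> 'a::{real_inner, complete_space} \<Rightarrow> 'a"
  assumes "hilbert_space s" "\<And>n. A n \<in> bounded_operators s s"
  shows "module.subspace s (bounded_orbits A n)"
proof -
  interpret hilbert_space s by fact
  have op: "cocycle A m n \<in> bounded_operators s s" for m
    by (rule cocycle_bounded_operator[OF vector_space_axioms assms(2)])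
  then have add: "cocycle A m n (u + v) = cocycle A m n u + cocycle A m n v"
    and zero: "cocycle A m n 0 = 0"
    and scale: "cocycle A m n (s c v) = s c (cocycle A m n v)" for m c u v
    by (auto simp: bounded_operators_def Vector_Spaces.linear_iff linear_simps)
  show ?thesis
  proof (rule subspaceI)
    fix u v assume "u \<in> bounded_orbits A n" "v \<in> bounded_orbits A n"
    then obtain M M' where "\<forall>m\<ge>n. norm (cocycle A m n u) \<le> M" "\<forall>m\<ge>n. norm (cocycle A m n v) \<le> M'"
      unfolding bounded_orbits_def by blast
    then have "\<forall>m\<ge>n. norm (cocycle A m n (u + v)) \<le> M + M'"
      by (auto simp: add intro: norm_triangle_mono)
    then show "u + v \<in> bounded_orbits A n"
      unfolding bounded_orbits_def by blast
  next
    fix c v assume "v \<in> bounded_orbits A n"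
    then obtain M where "\<forall>m\<ge>n. norm (cocycle A m n v) \<le> M"
      unfolding bounded_orbits_def by blast
    then have "\<forall>m\<ge>n. norm (cocycle A m n (s c v)) \<le> norm c * M"
      by (auto simp: scale norm_scale intro: mult_left_mono)
    then show "s c v \<in> bounded_orbits A n"
      unfolding bounded_orbits_def by blast
  qed (auto simp: bounded_orbits_def zero)
qed

text \<open>A linearly growing weight forces the sequence to halve after a fixed number of steps,
  and repeated halving is exponential decay. The constants depend on \<open>D\<close> alone. The
  horizon \<open>L\<close> is there for unstable orbits, which are followed backwards and end at
  time 0.\<close>

lemma exponential_decay:
  fixes D :: real
  assumes D: "D > 0"
  obtains K \<alpha> :: real where "K > 0" "\<alpha> > 0"
    "\<And>a L i j. (\<And>i. 0 \<le> a i) \<Longrightarrow>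
       (\<And>i j. i \<le> j \<Longrightarrow> j \<le> L \<Longrightarrow> (real (j - i) + 1) * a j \<le> D * a i) \<Longrightarrow>
       i \<le> j \<Longrightarrow> j \<le> L \<Longrightarrow> a j \<le> K * exp (- \<alpha> * (real j - real i)) * a i"
proof -
  \<comment> \<open>With this block length the weight \<open>N + 1\<close> is at least
    \<open>2 * D\<close>, which is what halving requires; the rate \<open>ln 2 / N\<close> below is
    one halving per block.\<close>
  define N where "N = nat \<lceil>2 * D\<rceil>"
  have N: "N > 0" "2 * D \<le> real N"
    using D unfolding N_def by linarith+
  define \<alpha> where "\<alpha> = ln 2 / real N"
  have \<alpha>: "\<alpha> > 0"
    using N by (simp add: \<alpha>_def)
  have main: "a j \<le> 2 * D * exp (- \<alpha> * (real j - real i)) * a i"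
    if nonneg: "\<And>i. 0 \<le> a i"
      and decay: "\<And>i j. i \<le> j \<Longrightarrow> j \<le> L \<Longrightarrow> (real (j - i) + 1) * a j \<le> D * a i"
      and ij: "i \<le> j" "j \<le> L" for a :: "nat \<Rightarrow> real" and L i j :: nat
  proof -
    have half: "a (k + N) \<le> a k / 2" if "k + N \<le> L" for k
    proof -
      have "2 * D * a (k + N) \<le> (real N + 1) * a (k + N)"
        using N nonneg[of "k + N"] by (intro mult_right_mono) auto
      also have "\<dots> \<le> D * a k"
        using decay[of k "k + N"] that by simp
      finally show ?thesis
        using D by simp
    qed
    have pow: "a (i + q * N) \<le> (1 / 2) ^ q * a i" if "i + q * N \<le> L" for q
      using that
    proof (induction q)
      case (Suc q)
      then show ?case
        using half[of "i + q * N"] by (simp add: algebra_simps)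
    qed simp
    define q where "q = (j - i) div N"
    have q: "i + q * N \<le> j"
      using ij by (simp add: q_def) (metis div_times_less_eq_dividend le_diff_conv2 add.commute)
    have "a j \<le> (real (j - (i + q * N)) + 1) * a j"
      using nonneg[of j] by (simp add: algebra_simps)
    also have "\<dots> \<le> D * a (i + q * N)"
      using decay q ij by blast
    \<comment> \<open>The last, incomplete block has already cost the factor \<open>D\<close>;
      rounding down to \<open>q\<close> full blocks costs the factor 2 introduced next. Hence the
      constant \<open>2 * D\<close>.\<close>
    also have "\<dots> \<le> D * ((1 / 2) ^ q * a i)"
      using pow q ij D by (intro mult_left_mono) auto
    also have "\<dots> \<le> D * ((2 * exp (- \<alpha> * (real j - real i))) * a i)"
    proof -
      have "j - i < (q + 1) * N"
        using N dividend_less_div_times[of N "j - i"] by (simp add: q_def add.commute)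
      then have "real j - real i \<le> (real q + 1) * real N"
        using ij by (metis of_nat_1 of_nat_add of_nat_diff of_nat_mult of_nat_less_iff less_imp_le)
      then have "\<alpha> * (real j - real i) \<le> \<alpha> * ((real q + 1) * real N)"
        using \<alpha> by (intro mult_left_mono) auto
      also have "\<dots> = (real q + 1) * ln 2"
        using N by (simp add: \<alpha>_def)
      finally have "- (real q * ln 2) \<le> ln 2 + - \<alpha> * (real j - real i)"
        by (simp add: algebra_simps)
      then have "exp (- (real q * ln 2)) \<le> exp (ln 2 + - \<alpha> * (real j - real i))"
        by simp
      moreover have "exp (- (real q * ln 2)) = (1 / 2 :: real) ^ q"
        by (simp add: exp_minus exp_of_nat_mult power_one_over inverse_eq_divide)
      ultimately have "(1 / 2) ^ q \<le> 2 * exp (- \<alpha> * (real j - real i))"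
        by (simp only: exp_add exp_ln)
      then show ?thesis
        using D nonneg by (intro mult_left_mono mult_right_mono) auto
    qed
    finally show ?thesis by (simp add: mult.assoc mult.left_commute)
  qed
  show thesis
  proof (rule that[of "2 * D" \<alpha>])
    show "2 * D > 0" using D by simp
  qed (fact \<alpha>, rule main)
qed

text \<open>The hypotheses of Perron's theorem with the complement \<open>Z\<close> fixed.
  \<open>Z\<close> becomes the unstable space at time 0, and its choice determines all projections,
  since the kernel at time \<open>n\<close> will be the image of \<open>Z\<close> under
  \<open>cocycle A n 0\<close>.\<close>

locale admissible_system = hilbert_space scale
  for scale :: "'k::{real_normed_field, euclidean_space} \<Rightarrow> 'a::{real_inner, complete_space} \<Rightarrow> 'a" +
  fixes A :: "nat \<Rightarrow> 'a \<Rightarrow> 'a" and Z :: "'a set"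
  assumes operators: "\<And>n. A n \<in> bounded_operators scale scale"
    and subspace_Z: "subspace Z" and closed_Z: "closed Z"
    and Int_Z: "bounded_initial_values A \<inter> Z = {0}"
    and sum_Z: "\<And>x. \<exists>u\<in>bounded_initial_values A. \<exists>z\<in>Z. x = u + z"
    and admissible: "\<And>y. bounded (range y) \<Longrightarrow>
      \<exists>x. bounded (range x) \<and> (\<forall>n. x (Suc n) = A n (x n) + y (Suc n))"
begin

section \<open>Bounded solutions of the perturbed equation\<close>

abbreviation \<Phi> :: "nat \<Rightarrow> nat \<Rightarrow> 'a \<Rightarrow> 'a" where "\<Phi> \<equiv> cocycle A"

lemma linear_\<Phi>: "Vector_Spaces.linear scale scale (\<Phi> m n)"
  and bounded_linear_\<Phi>: "bounded_linear (\<Phi> m n)"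
  using cocycle_bounded_operator[OF vector_space_axioms operators] by (auto simp: bounded_operators_def)

lemma bounded_linear_A: "bounded_linear (A n)"
  using operators by (auto simp: bounded_operators_def)

lemmas \<Phi>_simps = linear_simps[OF bounded_linear_\<Phi>]

lemmas A_simps = linear_simps[OF bounded_linear_A]

lemma \<Phi>_scale: "\<Phi> m n (scale c x) = scale c (\<Phi> m n x)"
  using linear_\<Phi> by (simp add: Vector_Spaces.linear_iff)

lemma scaleR_Z: "z \<in> Z \<Longrightarrow> r *\<^sub>R z \<in> Z"
  using subspace_scale[OF subspace_Z, of z "of_real r"] by (simp add: scale_of_real)

lemmas subspace_bounded_orbits = subspace_bounded_orbits_of_operators[OF hilbert_space_axioms operators]

text \<open>The initial condition involves \<open>y 0\<close> so that the solution for an impulse at time \<open>0\<close>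
  yields the projection onto the stable space along \<open>Z\<close>, like at all later times.\<close>

definition solves :: "(nat \<Rightarrow> 'a) \<Rightarrow> (nat \<Rightarrow> 'a) \<Rightarrow> bool"
  where "solves y x \<longleftrightarrow> x 0 - y 0 \<in> Z \<and> (\<forall>n. x (Suc n) = A n (x n) + y (Suc n))"

text \<open>The difference of two bounded solutions is a bounded orbit that starts in
  \<open>Z\<close>, so \<open>Int_Z\<close> makes its initial value vanish.\<close>

lemma solves_unique:
  assumes x: "solves y x" "bounded (range x)" and x': "solves y x'" "bounded (range x')"
  shows "x = x'"
proof -
  define w where "w n = x n - x' n" for n
  have w: "w n = \<Phi> n 0 (w 0)" for n
    using x x' by (intro cocycle_unique) (auto simp: w_def solves_def A_simps)
  have "(x 0 - y 0) - (x' 0 - y 0) \<in> Z"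
    using x x' by (intro subspace_diff[OF subspace_Z, of "x 0 - y 0" "x' 0 - y 0"]) (simp_all add: solves_def)
  then have "w 0 \<in> Z"
    by (simp add: w_def)
  moreover have "bounded (range w)"
    unfolding w_def using x x' by (intro bounded_minus_comp) auto
  then obtain M where "norm (w n) \<le> M" for n
    by (auto simp: bounded_iff)
  then have "norm (\<Phi> n 0 (w 0)) \<le> M" for n
    using w[of n] by metis
  then have "w 0 \<in> bounded_initial_values A"
    unfolding bounded_initial_values_eq bounded_orbits_def by blast
  ultimately have "w 0 = 0"
    using Int_Z by blast
  then have "w n = 0" for n
    using w[of n] by (simp add: \<Phi>_simps)
  then show ?thesis
    by (auto simp: w_def)
qed

text \<open>Any bounded solution is corrected by the bounded orbit through \<open>u\<close>, the
  stable part of \<open>x 0 - y 0\<close>; what remains of the initial value condition lies in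
  \<open>Z\<close>.\<close>

lemma solves_exists:
  assumes y: "bounded (range y)"
  obtains x where "solves y x" "bounded (range x)"
proof -
  obtain x where x: "bounded (range x)" "\<And>n. x (Suc n) = A n (x n) + y (Suc n)"
    using admissible[OF y] by blast
  obtain u z where uz: "u \<in> bounded_initial_values A" "z \<in> Z" "x 0 - y 0 = u + z"
    using sum_Z by blast
  obtain M where "\<And>n. norm (\<Phi> n 0 u) \<le> M"
    using uz(1) by (auto simp: bounded_initial_values_eq bounded_orbits_def)
  then have "bounded (range (\<lambda>n. \<Phi> n 0 u))"
    by (auto simp: bounded_iff)
  then have "bounded (range (\<lambda>n. x n - \<Phi> n 0 u))"
    using x by (intro bounded_minus_comp) auto
  moreover have "x 0 - u - y 0 = z"
    using uz by (simp add: algebra_simps)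
  then have "solves y (\<lambda>n. x n - \<Phi> n 0 u)"
    unfolding solves_def using x(2) uz(2) by (auto simp: cocycle_Suc A_simps)
  ultimately show thesis
    using that by blast
qed

text \<open>The solution operator \<open>G\<close> acts on the Banach space of bounded sequences.
  Its graph is closed because the equation and membership in the closed \<open>Z\<close> survive
  pointwise limits, so the closed graph theorem bounds it.\<close>

lemma solves_bound:
  obtains C where "C \<ge> 1"
    "\<And>x y M n. solves y x \<Longrightarrow> bounded (range x) \<Longrightarrow> (\<And>n. norm (y n) \<le> M) \<Longrightarrow> norm (x n) \<le> C * M"
proof -
  have "\<exists>x :: nat \<Rightarrow>\<^sub>C 'a. solves y x" for y :: "nat \<Rightarrow>\<^sub>C 'a"
  proof -
    obtain x where x: "solves y x" "bounded (range x)"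
      using solves_exists[OF bounded_apply_bcontfun] .
    then have "x \<in> bcontfun"
      by (simp add: bcontfun_def)
    then show ?thesis
      using x by (metis bcontfunE)
  qed
  then obtain G :: "(nat \<Rightarrow>\<^sub>C 'a) \<Rightarrow> nat \<Rightarrow>\<^sub>C 'a" where G: "\<And>y. solves (apply_bcontfun y) (apply_bcontfun (G y))"
    by metis
  have G_eq: "G y = x" if "solves y x" for x y :: "nat \<Rightarrow>\<^sub>C 'a"
    using solves_unique[OF that _ G] by (intro bcontfun_eqI) auto
  have "\<exists>C>0. \<forall>y. norm (G y) \<le> C * norm y"
  proof (rule closed_graph_bounded[OF complete_bcontfun_nat complete_bcontfun_nat])
    show "linear G"
    proof (rule linearI)
      fix y y' :: "nat \<Rightarrow>\<^sub>C 'a" and r :: real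
      have "(G y 0 - y 0) + (G y' 0 - y' 0) \<in> Z"
        using G by (intro subspace_add[OF subspace_Z]) (auto simp: solves_def)
      then have "solves (y + y') (G y + G y')"
        using G[of y] G[of y'] by (auto simp: solves_def A_simps algebra_simps)
      then show "G (y + y') = G y + G y'"
        by (rule G_eq)
      have "r *\<^sub>R (G y 0 - y 0) \<in> Z"
        using G by (intro scaleR_Z) (auto simp: solves_def)
      then have "solves (r *\<^sub>R y) (r *\<^sub>R G y)"
        using G[of y] by (auto simp: solves_def A_simps algebra_simps)
      then show "G (r *\<^sub>R y) = r *\<^sub>R G y"
        by (rule G_eq)
    qed
    fix u and y x :: "nat \<Rightarrow>\<^sub>C 'a"
    assume u: "u \<longlonglongrightarrow> y" and Gu: "(\<lambda>i. G (u i)) \<longlonglongrightarrow> x"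
    have at: "(\<lambda>i. f i n) \<longlonglongrightarrow> g n" if "f \<longlonglongrightarrow> g" for f and g :: "nat \<Rightarrow>\<^sub>C 'a" and n
      using that by (rule metric_tendsto_imp_tendsto) (simp add: dist_bounded)
    have "solves y x"
      unfolding solves_def
    proof (intro conjI allI)
      have "(\<lambda>i. G (u i) 0 - u i 0) \<longlonglongrightarrow> x 0 - y 0"
        by (intro tendsto_diff at u Gu)
      then show "x 0 - y 0 \<in> Z"
        by (rule closed_sequentially[OF closed_Z, rotated]) (use G in \<open>simp add: solves_def\<close>)
      fix n
      have "(\<lambda>i. A n (G (u i) n) + u i (Suc n)) \<longlonglongrightarrow> A n (x n) + y (Suc n)"
        by (intro tendsto_add bounded_linear.tendsto[OF bounded_linear_A] at u Gu)
      then have "(\<lambda>i. G (u i) (Suc n)) \<longlonglongrightarrow> A n (x n) + y (Suc n)"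
        using G by (simp add: solves_def)
      then show "x (Suc n) = A n (x n) + y (Suc n)"
        using at[OF Gu] LIMSEQ_unique by blast
    qed
    then show "G y = x"
      by (rule G_eq)
  qed
  then obtain C where C: "\<And>y. norm (G y) \<le> C * norm y"
    by blast
  \<comment> \<open>Enlarging the constant to at least 1 lets later estimates absorb the case of
    equal times.\<close>
  have "norm (x n) \<le> max C 1 * M" if xy: "solves y x" "bounded (range x)" "\<And>n. norm (y n) \<le> M"
    for x y M n
  proof -
    have "x \<in> bcontfun" "y \<in> bcontfun"
      using xy by (auto simp: bcontfun_def bounded_iff)
    then obtain x' y' :: "nat \<Rightarrow>\<^sub>C 'a" where x': "x = x'" and y': "y = y'"
      by (metis bcontfunE)
    have "norm (x n) \<le> norm (G y')"
      using G_eq[of y' x'] xy(1) norm_bounded[of x' n] x' y' by simp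
    also have "\<dots> \<le> C * norm y'"
      by (rule C)
    also have "\<dots> \<le> max C 1 * norm y'"
      by (intro mult_right_mono) auto
    also have "\<dots> \<le> max C 1 * M"
      using xy(3) y' by (intro mult_left_mono norm_bound) auto
    finally show ?thesis .
  qed
  then show thesis
    using that[of "max C 1"] by simp
qed

text \<open>An impulse \<open>a + \<Phi> n 0 z\<close> at time \<open>n\<close> is answered by the
  orbit of \<open>a\<close> from \<open>n\<close> on and by the negative orbit of \<open>z\<close>
  before. One solution thus bounds both components of a splitting, at every time, with a constant
  independent of \<open>n\<close>.\<close>

lemma impulse_bound:
  obtains C where "C \<ge> 1"
    "\<And>x y M n. solves y x \<Longrightarrow> bounded (range x) \<Longrightarrow> (\<And>n. norm (y n) \<le> M) \<Longrightarrow> norm (x n) \<le> C * M"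
    "\<And>n m a z. a \<in> bounded_orbits A n \<Longrightarrow> z \<in> Z \<Longrightarrow> n \<le> m \<Longrightarrow>
       norm (\<Phi> m n a) \<le> C * norm (a + \<Phi> n 0 z)"
    "\<And>n m a z. a \<in> bounded_orbits A n \<Longrightarrow> z \<in> Z \<Longrightarrow> m < n \<Longrightarrow>
       norm (\<Phi> m 0 z) \<le> C * norm (a + \<Phi> n 0 z)"
proof -
  obtain C where C: "C \<ge> 1"
    "\<And>x y M n. solves y x \<Longrightarrow> bounded (range x) \<Longrightarrow> (\<And>n. norm (y n) \<le> M) \<Longrightarrow> norm (x n) \<le> C * M"
    by (rule solves_bound) blast
  have key: "norm (if n \<le> m then \<Phi> m n a else - \<Phi> m 0 z) \<le> C * norm (a + \<Phi> n 0 z)"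
    if a: "a \<in> bounded_orbits A n" and z: "z \<in> Z" for n m a z
  proof -
    \<comment> \<open>The jump of \<open>x\<close> at time \<open>n > 0\<close> is exactly the
      impulse. For \<open>n = 0\<close> there is no earlier time, and the initial condition takes
      over: \<open>x 0 - y 0 = - z\<close>.\<close>
    define x where "x k = (if n \<le> k then \<Phi> k n a else - \<Phi> k 0 z)" for k
    define y where "y k = (if k = n then a + \<Phi> n 0 z else 0)" for k
    have "x (Suc k) = A k (x k) + y (Suc k)" for k
    proof -
      consider "Suc k < n" | "Suc k = n" | "n \<le> k" by linarith
      then show ?thesis
        by cases (auto simp: x_def y_def cocycle_Suc A_simps)
    qed
    moreover have "x 0 - y 0 \<in> Z"
      using subspace_neg[OF subspace_Z z] by (auto simp: x_def y_def)
    ultimately have "solves y x"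
      by (simp add: solves_def)
    moreover have y_le: "norm (y k) \<le> norm (a + \<Phi> n 0 z)" for k
      by (simp add: y_def)
    obtain M where M: "\<And>k. k \<ge> n \<Longrightarrow> norm (\<Phi> k n a) \<le> M"
      using a by (auto simp: bounded_orbits_def)
    have "norm (x k) \<le> max M (\<Sum>k<n. norm (\<Phi> k 0 z))" for k
    proof (cases "n \<le> k")
      case False
      then have "norm (\<Phi> k 0 z) \<le> (\<Sum>k<n. norm (\<Phi> k 0 z))"
        by (intro member_le_sum[where f="\<lambda>k. norm (\<Phi> k 0 z)"]) auto
      then show ?thesis
        using False by (simp add: x_def)
    qed (use M in \<open>auto simp: x_def intro: max.coboundedI1\<close>)
    then have "bounded (range x)"
      by (auto simp: bounded_iff)
    ultimately have "norm (x m) \<le> C * norm (a + \<Phi> n 0 z)"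
      using y_le by (intro C(2))
    then show ?thesis
      by (simp add: x_def)
  qed
  have b1: "norm (\<Phi> m n a) \<le> C * norm (a + \<Phi> n 0 z)"
    if "a \<in> bounded_orbits A n" "z \<in> Z" "n \<le> m" for n m a z
    using key[of a n z m] that by simp
  have b2: "norm (\<Phi> m 0 z) \<le> C * norm (a + \<Phi> n 0 z)"
    if "a \<in> bounded_orbits A n" "z \<in> Z" "m < n" for n m a z
    using key[of a n z m] that by simp
  show thesis
    by (rule that[of C]) (fact C(1), rule C(2), assumption+, rule b1, assumption+, rule b2)
qed

section \<open>The invariant splitting and its projections\<close>

lemma splitting_exists: "\<exists>a\<in>bounded_orbits A n. \<exists>z\<in>Z. v = a + \<Phi> n 0 z"
proof -
  define y where "y k = (if k = n then v else 0)" for k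
  have "bounded (range y)"
    by (auto simp: bounded_iff y_def intro!: exI[of _ "norm v"])
  then obtain x where x: "solves y x" "bounded (range x)"
    by (rule solves_exists)
  \<comment> \<open>The side condition says that the interval from \<open>k\<close> to
    \<open>m\<close> does not cross the impulse at time \<open>n\<close>.\<close>
  have forward: "x m = \<Phi> m k (x k)" if "k \<le> m" "m < n \<or> n \<le> k" for k m
    using that x(1) by (intro cocycle_unique) (auto simp: solves_def y_def)
  obtain M where "\<And>m. norm (x m) \<le> M"
    using x(2) by (auto simp: bounded_iff)
  then have "\<forall>m\<ge>n. norm (\<Phi> m n (x n)) \<le> M"
    using forward[of n] by (metis order_refl)
  then have a: "x n \<in> bounded_orbits A n"
    by (auto simp: bounded_orbits_def)
  have "y 0 - x 0 \<in> Z"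
    using x(1) subspace_neg[OF subspace_Z, of "x 0 - y 0"] by (simp add: solves_def)
  \<comment> \<open>The unstable component is read off at time 0. There \<open>y 0\<close> equals
    \<open>v\<close> if \<open>n = 0\<close> and vanishes otherwise.\<close>
  moreover have "v = x n + \<Phi> n 0 (y 0 - x 0)"
  proof (cases n)
    case 0
    then show ?thesis by (simp add: y_def)
  next
    case (Suc k)
    then have "x n = A k (\<Phi> k 0 (x 0)) + v"
      using x(1) forward[of 0 k] by (simp add: solves_def y_def)
    then show ?thesis
      using Suc by (simp add: y_def \<Phi>_simps cocycle_Suc)
  qed
  ultimately show ?thesis
    using a by blast
qed

definition P :: "nat \<Rightarrow> 'a \<Rightarrow> 'a"
  where "P n v = (SOME a. a \<in> bounded_orbits A n \<and> (\<exists>z\<in>Z. v = a + \<Phi> n 0 z))"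

text \<open>The difference of two splittings of the same vector splits 0, and the impulse bound at
  time \<open>n\<close> then bounds \<open>a - a'\<close> by 0.\<close>

lemma splitting_unique:
  assumes "a \<in> bounded_orbits A n" "z \<in> Z" "a' \<in> bounded_orbits A n" "z' \<in> Z"
    and eq: "a + \<Phi> n 0 z = a' + \<Phi> n 0 z'"
  shows "a = a'"
proof -
  obtain C where C: "\<And>n m a z. a \<in> bounded_orbits A n \<Longrightarrow> z \<in> Z \<Longrightarrow> n \<le> m \<Longrightarrow>
       norm (\<Phi> m n a) \<le> C * norm (a + \<Phi> n 0 z)"
    by (rule impulse_bound) blast
  have "norm (\<Phi> n n (a - a')) \<le> C * norm ((a - a') + \<Phi> n 0 (z - z'))"
    using assms by (intro C subspace_diff[OF subspace_Z] subspace_diff[OF subspace_bounded_orbits]) auto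
  also have "(a - a') + \<Phi> n 0 (z - z') = 0"
    using eq by (simp add: \<Phi>_simps algebra_simps)
  finally show ?thesis by simp
qed

lemma P_eq:
  assumes "a \<in> bounded_orbits A n" "z \<in> Z"
  shows "P n (a + \<Phi> n 0 z) = a"
  unfolding P_def
proof (rule some_equality)
  show "a \<in> bounded_orbits A n \<and> (\<exists>z'\<in>Z. a + \<Phi> n 0 z = a + \<Phi> n 0 z')"
    using assms by blast
  show "a' = a" if "a' \<in> bounded_orbits A n \<and> (\<exists>z'\<in>Z. a + \<Phi> n 0 z = a' + \<Phi> n 0 z')" for a'
    using that splitting_unique assms by metis
qed

lemma P_cases:
  obtains a z where "a \<in> bounded_orbits A n" "z \<in> Z" "v = a + \<Phi> n 0 z" "P n v = a"
  using splitting_exists[of n v] P_eq by blast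

lemma kernel_P: "kernel (P n) = \<Phi> n 0 ` Z"
proof
  show "kernel (P n) \<subseteq> \<Phi> n 0 ` Z"
  proof
    fix v assume "v \<in> kernel (P n)"
    then have "P n v = 0"
      by (simp add: kernel_def)
    moreover obtain a z where "z \<in> Z" "v = a + \<Phi> n 0 z" "P n v = a"
      by (rule P_cases)
    ultimately show "v \<in> \<Phi> n 0 ` Z" by simp
  qed
  have "0 \<in> bounded_orbits A n"
    using subspace_bounded_orbits by (rule subspace_0)
  then show "\<Phi> n 0 ` Z \<subseteq> kernel (P n)"
    using P_eq[of 0 n] by (auto simp: kernel_def)
qed

lemma P_bounded_operator: "P n \<in> bounded_operators scale scale"
proof -
  have add: "P n (v + w) = P n v + P n w" for v w
  proof -
    obtain a z where a: "a \<in> bounded_orbits A n" "z \<in> Z" "v = a + \<Phi> n 0 z" "P n v = a"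
      by (rule P_cases)
    obtain b u where b: "b \<in> bounded_orbits A n" "u \<in> Z" "w = b + \<Phi> n 0 u" "P n w = b"
      by (rule P_cases)
    have "v + w = (a + b) + \<Phi> n 0 (z + u)"
      using a b by (simp add: \<Phi>_simps)
    moreover have "a + b \<in> bounded_orbits A n" "z + u \<in> Z"
      using a b subspace_add[OF subspace_Z] subspace_add[OF subspace_bounded_orbits] by auto
    ultimately show ?thesis
      using P_eq a b by metis
  qed
  have scale: "P n (scale c v) = scale c (P n v)" for c v
  proof -
    obtain a z where a: "a \<in> bounded_orbits A n" "z \<in> Z" "v = a + \<Phi> n 0 z" "P n v = a"
      by (rule P_cases)
    have "scale c v = scale c a + \<Phi> n 0 (scale c z)"
      using a by (simp add: \<Phi>_scale scale_right_distrib)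
    moreover have "scale c a \<in> bounded_orbits A n" "scale c z \<in> Z"
      using a subspace_scale[OF subspace_Z] subspace_scale[OF subspace_bounded_orbits] by auto
    ultimately show ?thesis
      using P_eq a by metis
  qed
  obtain C where C: "\<And>n m a z. a \<in> bounded_orbits A n \<Longrightarrow> z \<in> Z \<Longrightarrow> n \<le> m \<Longrightarrow>
       norm (\<Phi> m n a) \<le> C * norm (a + \<Phi> n 0 z)"
    by (rule impulse_bound) blast
  have "norm (P n v) \<le> norm v * C" for v
  proof -
    obtain a z where "a \<in> bounded_orbits A n" "z \<in> Z" "v = a + \<Phi> n 0 z" "P n v = a"
      by (rule P_cases)
    then show ?thesis
      using C[of a n z n] by (simp add: mult.commute)
  qed
  then have "bounded_linear (P n)"
    using add scale[of "of_real _"] by (intro bounded_linear_intro) (auto simp: scale_of_real)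
  then show ?thesis
    using add scale vector_space_axioms by (simp add: bounded_operators_def Vector_Spaces.linear_iff)
qed

lemma A_P_commute: "A n (P n v) = P (Suc n) (A n v)"
proof -
  obtain a z where a: "a \<in> bounded_orbits A n" "z \<in> Z" "v = a + \<Phi> n 0 z" "P n v = a"
    by (rule P_cases)
  have "A n a \<in> bounded_orbits A (Suc n)"
    using bounded_orbits_cocycle_iff[of n "Suc n" A a] a by (simp add: cocycle_Suc)
  from P_eq[OF this a(2)] show ?thesis
    using a by (simp add: cocycle_Suc A_simps)
qed

text \<open>If two kernel vectors meet later, their difference has a bounded orbit. Then
  \<open>u = (u - v) + v\<close> is a second splitting of \<open>u\<close> besides
  \<open>0 + u\<close>, so \<open>u - v\<close> is 0.\<close>

lemma inj_on_\<Phi>_kernel: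
  assumes "m \<le> n"
  shows "inj_on (\<Phi> n m) (kernel (P m))"
proof (rule inj_onI)
  fix u v assume uv: "u \<in> kernel (P m)" "v \<in> kernel (P m)" "\<Phi> n m u = \<Phi> n m v"
  then obtain z z' where z: "z \<in> Z" "u = \<Phi> m 0 z" "z' \<in> Z" "v = \<Phi> m 0 z'"
    unfolding kernel_P by blast
  have "0 \<in> bounded_orbits A n"
    using subspace_bounded_orbits by (rule subspace_0)
  then have "u - v \<in> bounded_orbits A m"
    using uv(3) bounded_orbits_cocycle_iff[OF assms, of A "u - v"] by (simp add: \<Phi>_simps)
  moreover have "u - v + \<Phi> m 0 z' = 0 + \<Phi> m 0 z"
    using z by simp
  ultimately have "u - v = 0"
    using z splitting_unique[OF _ z(3) subspace_0[OF subspace_bounded_orbits] z(1)] by blast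
  then show "u = v" by simp
qed

lemma bij_betw_A_kernel: "bij_betw (A n) (kernel (P n)) (kernel (P (Suc n)))"
proof -
  have "inj_on (A n) (kernel (P n))"
    using inj_on_\<Phi>_kernel[of n "Suc n"] by (simp add: cocycle.simps(2) o_def)
  moreover have "A n ` kernel (P n) = kernel (P (Suc n))"
    by (simp add: kernel_P image_image cocycle_Suc)
  ultimately show ?thesis
    by (simp add: bij_betw_def)
qed

text \<open>A kernel vector lies on an orbit issued from \<open>Z\<close> at time 0, so going
  backwards means reading that orbit at an earlier time.\<close>

lemma backward_cocycle_eq:
  assumes "m \<le> n" "z \<in> Z"
  shows "backward_cocycle A P m n (\<Phi> n 0 z) = \<Phi> m 0 z"
proof -
  have "\<Phi> n 0 z = \<Phi> n m (\<Phi> m 0 z)"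
    using assms by (simp add: cocycle_cocycle)
  then show ?thesis
    unfolding backward_cocycle_def using assms inj_on_\<Phi>_kernel[of m n]
    by (simp add: kernel_P)
qed

text \<open>Perturbing the system with an orbit itself on a time window has the orbit times a linearly
  growing factor as solution, so the solution bound controls that product.\<close>

lemma linear_growth_bounds:
  obtains D where "D > 0"
    "\<And>p q a. a \<in> bounded_orbits A p \<Longrightarrow> p \<le> q \<Longrightarrow> (real (q - p) + 1) * norm (\<Phi> q p a) \<le> D * norm a"
    "\<And>p q z. z \<in> Z \<Longrightarrow> p \<le> q \<Longrightarrow> (real (q - p) + 1) * norm (\<Phi> p 0 z) \<le> D * norm (\<Phi> q 0 z)"
proof -
  obtain C where C: "C \<ge> 1"
    "\<And>x y M n. solves y x \<Longrightarrow> bounded (range x) \<Longrightarrow> (\<And>n. norm (y n) \<le> M) \<Longrightarrow> norm (x n) \<le> C * M"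
    "\<And>n m a z. a \<in> bounded_orbits A n \<Longrightarrow> z \<in> Z \<Longrightarrow> n \<le> m \<Longrightarrow>
       norm (\<Phi> m n a) \<le> C * norm (a + \<Phi> n 0 z)"
    "\<And>n m a z. a \<in> bounded_orbits A n \<Longrightarrow> z \<in> Z \<Longrightarrow> m < n \<Longrightarrow>
       norm (\<Phi> m 0 z) \<le> C * norm (a + \<Phi> n 0 z)"
    by (rule impulse_bound) blast
  have Z0: "0 \<in> Z"
    by (rule subspace_0[OF subspace_Z])
  have stable: "norm (\<Phi> m n a) \<le> C * norm a" if "a \<in> bounded_orbits A n" "n \<le> m" for n m a
    using C(3)[OF that(1) Z0 that(2)] by (simp add: \<Phi>_simps)
  have unstable: "norm (\<Phi> m 0 z) \<le> C * norm (\<Phi> n 0 z)" if "z \<in> Z" "m \<le> n" for n m z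
  proof (cases "m = n")
    case True
    then show ?thesis
      using mult_right_mono[OF C(1) norm_ge_zero[of "\<Phi> n 0 z"]] by simp
  next
    case False
    then show ?thesis
      using C(4)[OF subspace_0[OF subspace_bounded_orbits] that(1), of m n] that by simp
  qed
  have forward: "(real (q - p) + 1) * norm (\<Phi> q p a) \<le> C * (C * norm a)"
    if a: "a \<in> bounded_orbits A p" and pq: "p \<le> q" for p q a
  proof -
    \<comment> \<open>The factor counts the perturbations received so far: it is 1 at time
      \<open>p\<close>, reaches \<open>q - p + 1\<close> at time \<open>q\<close> and stays constant
      afterwards.\<close>
    define x where "x m = (if p \<le> m then real (min m q - p + 1) *\<^sub>R \<Phi> m p a else 0)" for m
    define y where "y m = (if p \<le> m \<and> m \<le> q then \<Phi> m p a else 0)" for m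
    have "norm (x q) \<le> C * (C * norm a)"
    proof (rule C(2))
      have "x (Suc k) = A k (x k) + y (Suc k)" for k
      proof -
        consider "Suc k < p" | "Suc k = p" | "p \<le> k" "Suc k \<le> q" | "p \<le> k" "q \<le> k" by linarith
        then show ?thesis
        proof cases
          case 3
          then have "min (Suc k) q - p + 1 = (min k q - p + 1) + 1"
            by simp
          then have "x (Suc k) = (real (min k q - p + 1) + 1) *\<^sub>R \<Phi> (Suc k) p a"
            using 3 by (simp add: x_def)
          then show ?thesis
            using 3 by (simp add: x_def y_def cocycle_Suc A_simps scaleR_2 algebra_simps)
        qed (use pq in \<open>auto simp: x_def y_def cocycle_Suc A_simps\<close>)
      qed
      moreover have "x 0 - y 0 = 0"
        using pq by (auto simp: x_def y_def)
      ultimately show "solves y x"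
        using Z0 by (simp add: solves_def)
      have "norm (x m) \<le> real (q + 1) * (C * norm a)" for m
        using stable[OF a, of m] C(1) unfolding x_def by (auto intro!: mult_mono)
      then show "bounded (range x)"
        by (auto simp: bounded_iff)
      show "norm (y m) \<le> C * norm a" for m
        using stable[OF a, of m] C(1) by (auto simp: y_def)
    qed
    then show ?thesis
      using pq by (simp add: x_def add.commute)
  qed
  have backward: "real (q - p) * norm (\<Phi> p 0 z) \<le> C * (C * norm (\<Phi> q 0 z))"
    if z: "z \<in> Z" and pq: "p \<le> q" for p q z
  proof -
    \<comment> \<open>The factor is constant up to time \<open>p\<close>, so that
      \<open>x 0 - y 0\<close> is a multiple of \<open>z\<close>, and then falls by one per step;
      truncated subtraction makes it 0 from time \<open>q\<close> on.\<close>
    define x where "x m = real (q - max m p) *\<^sub>R \<Phi> m 0 z" for m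
    define y where "y m = (if p < m \<and> m \<le> q then - \<Phi> m 0 z else 0)" for m
    have "norm (x p) \<le> C * (C * norm (\<Phi> q 0 z))"
    proof (rule C(2))
      have "x (Suc k) = A k (x k) + y (Suc k)" for k
      proof -
        consider "Suc k \<le> p" | "p \<le> k" "Suc k \<le> q" | "p \<le> k" "q \<le> k" by linarith
        then show ?thesis
        proof cases
          case 2
          then have "real (q - max k p) = real (q - max (Suc k) p) + 1"
            by (simp add: max_def)
          then show ?thesis
            using 2 by (simp add: x_def y_def cocycle_Suc A_simps scaleR_2 algebra_simps)
        qed (use pq in \<open>auto simp: x_def y_def cocycle_Suc A_simps max_def\<close>)
      qed
      moreover have "x 0 - y 0 \<in> Z"
        using scaleR_Z[OF z] by (simp add: x_def y_def)
      ultimately show "solves y x"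
        by (simp add: solves_def)
      have "norm (x m) \<le> real q * (C * norm (\<Phi> q 0 z))" for m
      proof (cases "m \<le> q")
        case True
        then show ?thesis
          using unstable[OF z, of m q] C(1) unfolding x_def by (auto intro!: mult_mono)
      qed (use C(1) in \<open>simp add: x_def\<close>)
      then show "bounded (range x)"
        by (auto simp: bounded_iff)
      show "norm (y m) \<le> C * norm (\<Phi> q 0 z)" for m
        using unstable[OF z, of m q] C(1) by (auto simp: y_def)
    qed
    then show ?thesis
      by (simp add: x_def)
  qed
  show thesis
  \<comment> \<open>The backward window yields only the factor \<open>q - p\<close>; the missing
    unit comes from the plain bound \<open>unstable\<close>, which adds \<open>C\<close> to
    \<open>C * C\<close>.\<close>
  proof (rule that[of "C * C + C"])
    show "C * C + C > 0"
      using C(1) by (simp add: add_pos_pos)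
    show "(real (q - p) + 1) * norm (\<Phi> q p a) \<le> (C * C + C) * norm a"
      if "a \<in> bounded_orbits A p" "p \<le> q" for p q a
      using order_trans[OF forward[OF that], of "(C * C + C) * norm a"] C(1)
      by (simp add: algebra_simps)
    show "(real (q - p) + 1) * norm (\<Phi> p 0 z) \<le> (C * C + C) * norm (\<Phi> q 0 z)"
      if "z \<in> Z" "p \<le> q" for p q z
      using add_mono[OF backward[OF that] unstable[OF that]] by (simp add: algebra_simps)
  qed
qed

theorem exp_dichotomy_with_P: "exp_dichotomy_with scale A P"
proof -
  obtain D where D: "D > 0"
    "\<And>p q a. a \<in> bounded_orbits A p \<Longrightarrow> p \<le> q \<Longrightarrow> (real (q - p) + 1) * norm (\<Phi> q p a) \<le> D * norm a"
    "\<And>p q z. z \<in> Z \<Longrightarrow> p \<le> q \<Longrightarrow> (real (q - p) + 1) * norm (\<Phi> p 0 z) \<le> D * norm (\<Phi> q 0 z)"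
    by (rule linear_growth_bounds) blast
  obtain C where C: "C \<ge> 1"
    "\<And>n m a z. a \<in> bounded_orbits A n \<Longrightarrow> z \<in> Z \<Longrightarrow> n \<le> m \<Longrightarrow>
       norm (\<Phi> m n a) \<le> C * norm (a + \<Phi> n 0 z)"
    by (rule impulse_bound) blast
  obtain K \<alpha> :: real where K: "K > 0" "\<alpha> > 0" and
    decay: "\<And>a L i j. (\<And>i. 0 \<le> a i) \<Longrightarrow>
       (\<And>i j. i \<le> j \<Longrightarrow> j \<le> L \<Longrightarrow> (real (j - i) + 1) * a j \<le> D * a i) \<Longrightarrow>
       i \<le> j \<Longrightarrow> j \<le> L \<Longrightarrow> a j \<le> K * exp (- \<alpha> * (real j - real i)) * a i"
    using exponential_decay[OF D(1)] by metis
  have P_le: "norm (P n v) \<le> C * norm v" for n v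
  proof -
    obtain a z where "a \<in> bounded_orbits A n" "z \<in> Z" "v = a + \<Phi> n 0 z" "P n v = a"
      by (rule P_cases)
    then show ?thesis
      using C(2)[of a n z n] by simp
  qed
  have stable: "norm (\<Phi> m n (P n v)) \<le> K * (1 + C) * exp (- \<alpha> * (real m - real n)) * norm v"
    if "n \<le> m" for m n v
  proof -
    obtain a where a: "a \<in> bounded_orbits A n" "P n v = a"
      by (rule P_cases)
    have "norm (\<Phi> (n + (m - n)) n a)
        \<le> K * exp (- \<alpha> * (real (m - n) - real 0)) * norm (\<Phi> (n + 0) n a)"
    proof (rule decay[where L = "m - n" and a = "\<lambda>i. norm (\<Phi> (n + i) n a)"])
      fix i j :: nat assume ij: "i \<le> j"
      have "\<Phi> (n + i) n a \<in> bounded_orbits A (n + i)"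
        using a by (simp add: bounded_orbits_cocycle_iff)
      from D(2)[OF this, of "n + j"] ij
      show "(real (j - i) + 1) * norm (\<Phi> (n + j) n a) \<le> D * norm (\<Phi> (n + i) n a)"
        by (simp add: cocycle_cocycle)
    qed auto
    also have "\<dots> \<le> K * exp (- \<alpha> * (real m - real n)) * (C * norm v)"
      using P_le[of n v] K that a by (simp add: of_nat_diff)
    also have "\<dots> \<le> K * exp (- \<alpha> * (real m - real n)) * ((1 + C) * norm v)"
      using K by (intro mult_left_mono mult_right_mono) auto
    finally show ?thesis
      using that a by (simp add: ac_simps)
  qed
  have unstable: "norm (backward_cocycle A P m n (v - P n v))
      \<le> K * (1 + C) * exp (- \<alpha> * (real n - real m)) * norm v"
    if "m \<le> n" for m n v
  proof -
    obtain a z where z: "z \<in> Z" "v = a + \<Phi> n 0 z" "P n v = a"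
      by (rule P_cases)
    then have vz: "v - P n v = \<Phi> n 0 z" by simp
    have "norm (\<Phi> (n - (n - m)) 0 z)
        \<le> K * exp (- \<alpha> * (real (n - m) - real 0)) * norm (\<Phi> (n - 0) 0 z)"
    \<comment> \<open>Time is reversed by \<open>n - i\<close>; the horizon \<open>n\<close> keeps
      this subtraction from being truncated.\<close>
    proof (rule decay[where L = n and a = "\<lambda>i. norm (\<Phi> (n - i) 0 z)"])
      fix i j :: nat assume "i \<le> j" "j \<le> n"
      then show "(real (j - i) + 1) * norm (\<Phi> (n - j) 0 z) \<le> D * norm (\<Phi> (n - i) 0 z)"
        using D(3)[OF z(1), of "n - j" "n - i"] by simp
    qed auto
    then have "norm (\<Phi> m 0 z) \<le> K * exp (- \<alpha> * (real n - real m)) * norm (v - P n v)"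
      using that by (simp add: vz of_nat_diff)
    \<comment> \<open>\<open>1 + C\<close> bounds the complementary projection, uniformly in
      \<open>n\<close>; the stable estimate is weakened to the same factor to share one
      constant.\<close>
    also have "\<dots> \<le> K * exp (- \<alpha> * (real n - real m)) * ((1 + C) * norm v)"
    proof -
      have "norm (v - P n v) \<le> (1 + C) * norm v"
        using norm_triangle_ineq4[of v "P n v"] P_le[of n v] by (simp add: algebra_simps)
      then show ?thesis
        using K by (intro mult_left_mono) auto
    qed
    finally show ?thesis
      using that z by (simp add: vz backward_cocycle_eq ac_simps)
  qed
  have "P n \<circ> P n = P n" for n
  proof
    fix v
    obtain a where a: "a \<in> bounded_orbits A n" "P n v = a"
      by (rule P_cases)
    then show "(P n \<circ> P n) v = P n v"
      using P_eq[OF a(1) subspace_0[OF subspace_Z]] by (simp add: \<Phi>_simps)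
  qed
  moreover have "K * (1 + C) > 0"
    using K C by simp
  ultimately show ?thesis
    unfolding exp_dichotomy_with_def
    using P_bounded_operator A_P_commute bij_betw_A_kernel stable unstable K(2)
    by (intro conjI allI exI[of _ "K * (1 + C)"] exI[of _ \<alpha>]) (auto simp: fun_eq_iff)
qed

end

theorem exp_dichotomy_if_admissible:
  fixes A :: "nat \<Rightarrow> 'a::{real_inner, complete_space} \<Rightarrow> 'a"
  assumes "hilbert_space s" "\<And>n. A n \<in> bounded_operators s s"
    and "complemented s (bounded_initial_values A)"
    and "\<And>y. bounded (range y) \<Longrightarrow> \<exists>x. bounded (range x) \<and> (\<forall>n. x (Suc n) = A n (x n) + y (Suc n))"
  shows "exp_dichotomy s A"
proof -
  interpret hilbert_space s by fact
  obtain Z where "subspace Z" "closed Z" "bounded_initial_values A \<inter> Z = {0}"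
    "\<forall>x. \<exists>u\<in>bounded_initial_values A. \<exists>z\<in>Z. x = u + z"
    using assms(3) unfolding complemented_def by blast
  then interpret admissible_system s A Z
    using assms by unfold_locales auto
  show ?thesis
    using exp_dichotomy_with_P by (auto simp: exp_dichotomy_def)
qed

section \<open>Admissibility of dichotomous systems\<close>

locale dichotomous_system = hilbert_space scale
  for scale :: "'k::{real_normed_field, euclidean_space} \<Rightarrow> 'a::{real_inner, complete_space} \<Rightarrow> 'a" +
  fixes A P :: "nat \<Rightarrow> 'a \<Rightarrow> 'a" and K \<alpha> :: real
  assumes operators: "\<And>n. A n \<in> bounded_operators scale scale"
    and projections: "\<And>n. P n \<in> bounded_operators scale scale"
    and P_idem [simp]: "\<And>n x. P n (P n x) = P n x"
    and P_commute: "\<And>n x. P (Suc n) (A n x) = A n (P n x)"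
    and bij_betw_A: "\<And>n. bij_betw (A n) (kernel (P n)) (kernel (P (Suc n)))"
    and K_pos: "K > 0" and \<alpha>_pos: "\<alpha> > 0"
    and stable: "\<And>m n x. n \<le> m \<Longrightarrow>
      norm (cocycle A m n (P n x)) \<le> K * exp (- \<alpha> * (real m - real n)) * norm x"
    and unstable: "\<And>m n x. m \<le> n \<Longrightarrow>
      norm (backward_cocycle A P m n (x - P n x)) \<le> K * exp (- \<alpha> * (real n - real m)) * norm x"

lemma exp_dichotomy_with_imp_dichotomous_system:
  assumes "hilbert_space s" "\<And>n. A n \<in> bounded_operators s s" "exp_dichotomy_with s A P"
  obtains K \<alpha> where "dichotomous_system s A P K \<alpha>"
proof -
  interpret hilbert_space s by fact
  obtain K \<alpha> where "K > 0" "\<alpha> > 0"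
    "\<forall>m n x. n \<le> m \<longrightarrow> norm (cocycle A m n (P n x)) \<le> K * exp (- \<alpha> * (real m - real n)) * norm x"
    "\<forall>m n x. m \<le> n \<longrightarrow>
       norm (backward_cocycle A P m n (x - P n x)) \<le> K * exp (- \<alpha> * (real n - real m)) * norm x"
    using assms(3) unfolding exp_dichotomy_with_def by blast
  moreover have "\<And>n. P n \<in> bounded_operators s s" "\<And>n. P n \<circ> P n = P n"
    "\<And>n. A n \<circ> P n = P (Suc n) \<circ> A n" "\<And>n. bij_betw (A n) (kernel (P n)) (kernel (P (Suc n)))"
    using assms(3) unfolding exp_dichotomy_with_def by auto
  ultimately have "dichotomous_system s A P K \<alpha>"
    using assms(2) by unfold_locales (auto simp: fun_eq_iff)
  then show thesis
    by (rule that)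
qed

context dichotomous_system
begin

lemma bounded_linear_P: "bounded_linear (P n)"
  and linear_P: "Vector_Spaces.linear scale scale (P n)"
  using projections by (auto simp: bounded_operators_def)

lemma bounded_linear_A: "bounded_linear (A n)"
  using operators by (auto simp: bounded_operators_def)

lemma bounded_linear_cocycle: "bounded_linear (cocycle A m n)"
  using cocycle_bounded_operator[OF vector_space_axioms operators] by (auto simp: bounded_operators_def)

lemmas P_simps = linear_simps[OF bounded_linear_P]
lemmas A_simps = linear_simps[OF bounded_linear_A]
lemmas cocycle_linear_simps = linear_simps[OF bounded_linear_cocycle]

lemma diff_P_in_kernel: "x - P n x \<in> kernel (P n)"
  by (simp add: kernel_def P_simps)

lemma kernel_diff_P: "x \<in> kernel (P n) \<Longrightarrow> x - P n x = x"
  by (simp add: kernel_def)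

lemma cocycle_P:
  assumes "n \<le> m"
  shows "P m (cocycle A m n x) = cocycle A m n (P n x)"
  using assms by (induction m rule: dec_induct) (auto simp: cocycle_Suc P_commute)

lemma bij_betw_cocycle:
  assumes "n \<le> m"
  shows "bij_betw (cocycle A m n) (kernel (P n)) (kernel (P m))"
  using assms
proof (induction m rule: dec_induct)
  case base
  then show ?case by (simp add: bij_betw_def inj_on_def)
next
  case (step m)
  then show ?case
    using bij_betw_trans[OF step.IH bij_betw_A[of m]] by (simp add: cocycle.simps(2) o_def)
qed

lemma backward_cocycle_kernel:
  assumes "m \<le> n" "u \<in> kernel (P n)"
  shows "backward_cocycle A P m n u \<in> kernel (P m)"
    and "cocycle A n m (backward_cocycle A P m n u) = u"
    and "norm (backward_cocycle A P m n u) \<le> K * exp (- \<alpha> * (real n - real m)) * norm u"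
proof -
  have "u \<in> cocycle A n m ` kernel (P m)"
    using bij_betw_cocycle[OF assms(1)] assms(2) by (simp add: bij_betw_def)
  then show "backward_cocycle A P m n u \<in> kernel (P m)"
    "cocycle A n m (backward_cocycle A P m n u) = u"
    unfolding backward_cocycle_def by (rule inv_into_into, rule f_inv_into_f)
  show "norm (backward_cocycle A P m n u) \<le> K * exp (- \<alpha> * (real n - real m)) * norm u"
    using unstable[OF assms(1), of u] kernel_diff_P[OF assms(2)] by simp
qed

lemma backward_cocycle_cocycle:
  assumes "m \<le> n" "u \<in> kernel (P m)"
  shows "backward_cocycle A P m n (cocycle A n m u) = u"
  using bij_betw_cocycle[OF assms(1)] assms(2)
  by (simp add: backward_cocycle_def bij_betw_def)

text \<open>Both sides lie in the kernel at time \<open>Suc m\<close> and are carried to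
  \<open>u\<close> by a cocycle that is injective there.\<close>

lemma A_backward_cocycle:
  assumes "m < n" "u \<in> kernel (P n)"
  shows "A m (backward_cocycle A P m n u) = backward_cocycle A P (Suc m) n u"
proof -
  let ?w = "backward_cocycle A P m n u"
  have w: "?w \<in> kernel (P m)" "cocycle A n m ?w = u"
    using backward_cocycle_kernel[of m n u] assms by auto
  have "A m ?w \<in> kernel (P (Suc m))"
    using bij_betw_A[of m] w(1) by (auto simp: bij_betw_def)
  moreover have "cocycle A n (Suc m) (A m ?w) = u"
    using cocycle_cocycle[of m "Suc m" n A ?w] assms w(2) by (simp add: cocycle_Suc)
  ultimately show ?thesis
    using backward_cocycle_cocycle[of "Suc m" n "A m ?w"] assms by simp
qed

lemma P_in_bounded_orbits: "P n x \<in> bounded_orbits A n"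
proof -
  have "norm (cocycle A m n (P n x)) \<le> K * norm x" if "n \<le> m" for m
  proof -
    have "norm (cocycle A m n (P n x)) \<le> K * exp (- \<alpha> * (real m - real n)) * norm x"
      by (rule stable[OF that])
    also have "\<dots> \<le> K * 1 * norm x"
      using that K_pos \<alpha>_pos by (intro mult_right_mono mult_left_mono) auto
    finally show ?thesis by simp
  qed
  then show ?thesis
    unfolding bounded_orbits_def by blast
qed

lemma exp_decay_tendsto: "(\<lambda>n. C * exp (- \<alpha> * (real n - real m))) \<longlonglongrightarrow> 0"
proof -
  have "(\<lambda>n. C * exp (\<alpha> * real m) * exp (- \<alpha>) ^ n) \<longlonglongrightarrow> 0"
    using \<alpha>_pos by (intro tendsto_mult_right_zero LIMSEQ_power_zero) simp
  moreover have "C * exp (\<alpha> * real m) * exp (- \<alpha>) ^ n = C * exp (- \<alpha> * (real n - real m))" for n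
    by (simp add: exp_of_nat_mult[symmetric] exp_add[symmetric] algebra_simps)
  ultimately show ?thesis by simp
qed

text \<open>The unstable part of \<open>v\<close> is recovered by pulling back from time
  \<open>n\<close> the unstable part of its orbit. If the orbit is bounded, this pullback decays
  exponentially in \<open>n\<close>, so it is 0. In particular the range of \<open>P 0\<close>
  depends on the system alone.\<close>

lemma bounded_initial_values_dichotomous: "bounded_initial_values A = {v. v - P 0 v = 0}"
proof (intro set_eqI iffI)
  fix v assume "v \<in> bounded_initial_values A"
  then obtain M where M: "\<And>n. norm (cocycle A n 0 v) \<le> M"
    by (auto simp: bounded_initial_values_eq bounded_orbits_def)
  have "norm (v - P 0 v) \<le> K * M * exp (- \<alpha> * (real n - real 0))" for n
  proof -
    have "cocycle A n 0 v - P n (cocycle A n 0 v) = cocycle A n 0 (v - P 0 v)"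
      by (simp add: cocycle_P cocycle_linear_simps)
    then have "v - P 0 v = backward_cocycle A P 0 n (cocycle A n 0 v - P n (cocycle A n 0 v))"
      using backward_cocycle_cocycle[OF _ diff_P_in_kernel] by simp
    then have "norm (v - P 0 v) \<le> K * exp (- \<alpha> * (real n - real 0)) * norm (cocycle A n 0 v)"
      using unstable[of 0 n "cocycle A n 0 v"] by simp
    also have "\<dots> \<le> K * exp (- \<alpha> * (real n - real 0)) * M"
      using M K_pos by (intro mult_left_mono) auto
    finally show ?thesis by (simp add: ac_simps)
  qed
  then have "norm (v - P 0 v) \<le> 0"
    by (intro LIMSEQ_le_const[OF exp_decay_tendsto[of "K * M" 0]]) blast
  then show "v \<in> {v. v - P 0 v = 0}" by simp
next
  fix v assume "v \<in> {v. v - P 0 v = 0}"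
  then show "v \<in> bounded_initial_values A"
    using P_in_bounded_orbits[of 0 v] by (simp add: bounded_initial_values_eq)
qed

lemma admissible_stable_part:
  assumes y: "bounded (range y)"
  obtains x where "bounded (range x)" "\<And>n. x (Suc n) = A n (x n) + P (Suc n) (y (Suc n))"
proof -
  obtain M where M: "\<And>n. norm (y n) \<le> M"
    using y by (auto simp: bounded_iff)
  define r where "r = exp (- \<alpha>)"
  have r: "0 < r" "r < 1"
    using \<alpha>_pos by (auto simp: r_def)
  \<comment> \<open>Variation of constants over the past, with zero initial value.\<close>
  define x where "x m = (\<Sum>j<m. cocycle A m (Suc j) (P (Suc j) (y (Suc j))))" for m
  have "x (Suc m) = A m (x m) + P (Suc m) (y (Suc m))" for m
    by (simp add: x_def cocycle_Suc linear_sum[OF bounded_linear.linear[OF bounded_linear_A]])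
  moreover have "norm (x m) \<le> K * M * (1 / (1 - r))" for m
  proof -
    have "norm (x m) \<le> (\<Sum>j<m. K * M * r ^ (m - Suc j))"
      unfolding x_def
    proof (intro sum_norm_le)
      fix j assume j: "j \<in> {..<m}"
      have "norm (cocycle A m (Suc j) (P (Suc j) (y (Suc j))))
          \<le> K * exp (- \<alpha> * (real m - real (Suc j))) * norm (y (Suc j))"
        using j by (intro stable) auto
      also have "exp (- \<alpha> * (real m - real (Suc j))) = r ^ (m - Suc j)"
        using j by (simp add: r_def exp_of_nat_mult[symmetric] of_nat_diff algebra_simps)
      also have "K * r ^ (m - Suc j) * norm (y (Suc j)) \<le> K * r ^ (m - Suc j) * M"
        using M K_pos r by (intro mult_left_mono) auto
      finally show "norm (cocycle A m (Suc j) (P (Suc j) (y (Suc j)))) \<le> K * M * r ^ (m - Suc j)"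
        by (simp add: ac_simps)
    qed
    also have "\<dots> = K * M * (\<Sum>i<m. r ^ i)"
      by (simp add: sum_distrib_left sum.nat_diff_reindex[of "\<lambda>i. K * M * r ^ i"])
    also have "\<dots> \<le> K * M * (1 / (1 - r))"
    proof (intro mult_left_mono)
      show "(\<Sum>i<m. r ^ i) \<le> 1 / (1 - r)"
        using r by (simp add: sum_gp_strict divide_right_mono)
      show "0 \<le> K * M"
        using K_pos order_trans[OF norm_ge_zero M] by simp
    qed
    finally show ?thesis .
  qed
  ultimately show thesis
    using that[of x] by (auto simp: bounded_iff)
qed

text \<open>Unstable perturbations are summed from the future: the solution at time \<open>m\<close>
  is minus the sum of their pullbacks from all times after \<open>m\<close>.\<close>

lemma admissible_unstable_part:
  assumes y: "bounded (range y)"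
  obtains x where "bounded (range x)"
    "\<And>n. x (Suc n) = A n (x n) + (y (Suc n) - P (Suc n) (y (Suc n)))"
proof -
  obtain M where M: "\<And>n. norm (y n) \<le> M"
    using y by (auto simp: bounded_iff)
  define r where "r = exp (- \<alpha>)"
  have r: "0 < r" "r < 1"
    using \<alpha>_pos by (auto simp: r_def)
  define q where "q n = y n - P n (y n)" for n
  have q: "q n \<in> kernel (P n)" for n
    unfolding q_def by (rule diff_P_in_kernel)
  define t where "t m i = backward_cocycle A P m (Suc m + i) (q (Suc m + i))" for m i
  have t_le: "norm (t m i) \<le> K * M * r ^ i" for m i
  proof -
    have "norm (t m i) \<le> K * exp (- \<alpha> * (real (Suc m + i) - real m)) * norm (y (Suc m + i))"
      unfolding t_def q_def by (rule unstable) simp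
    also have "exp (- \<alpha> * (real (Suc m + i) - real m)) = r * r ^ i"
      by (simp add: r_def exp_of_nat_mult[symmetric] exp_add[symmetric] algebra_simps)
    also have "K * (r * r ^ i) * norm (y (Suc m + i)) \<le> K * (1 * r ^ i) * M"
      using M K_pos r by (intro mult_mono mult_left_mono mult_right_mono) auto
    finally show ?thesis by (simp add: ac_simps)
  qed
  have "\<exists>l. t m sums l \<and> norm l \<le> K * M / (1 - r)" for m
    using geometric_sums_complete[OF complete_UNIV, of r "t m"] r t_le by (metis less_imp_le)
  then obtain s where s: "\<And>m. t m sums s m" "\<And>m. norm (s m) \<le> K * M / (1 - r)"
    by metis
  have "s (Suc m) = A m (s m) - q (Suc m)" for m
  proof -
    \<comment> \<open>Advancing by one step shifts the series. Its first term arrives at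
      \<open>q (Suc m)\<close>, which is no longer in the future and becomes the
      perturbation.\<close>
    have "A m (t m i) = (case i of 0 \<Rightarrow> q (Suc m) | Suc j \<Rightarrow> t (Suc m) j)" for i
    proof -
      have "A m (t m i) = backward_cocycle A P (Suc m) (Suc m + i) (q (Suc m + i))"
        unfolding t_def by (rule A_backward_cocycle) (auto simp: q)
      then show ?thesis
        using backward_cocycle_cocycle[OF order_refl q] by (auto simp: t_def split: nat.split)
    qed
    then have "(\<lambda>i. case i of 0 \<Rightarrow> q (Suc m) | Suc j \<Rightarrow> t (Suc m) j) sums A m (s m)"
      using bounded_linear.sums[OF bounded_linear_A s(1), of m m] by simp
    moreover have "(\<lambda>i. case i of 0 \<Rightarrow> q (Suc m) | Suc j \<Rightarrow> t (Suc m) j) sums (s (Suc m) + q (Suc m))"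
      using s(1)[of "Suc m"] sums_Suc[of "\<lambda>i. case i of 0 \<Rightarrow> q (Suc m) | Suc j \<Rightarrow> t (Suc m) j"]
      by simp
    ultimately show ?thesis
      using sums_unique2 by fastforce
  qed
  then have "- s (Suc m) = A m (- s m) + q (Suc m)" for m
    by (simp add: A_simps)
  moreover have "bounded (range (\<lambda>m. - s m))"
    using s(2) by (auto simp: bounded_iff)
  ultimately show thesis
    using that[of "\<lambda>m. - s m"] by (simp add: q_def)
qed

theorem admissible:
  assumes "bounded (range y)"
  shows "\<exists>x. bounded (range x) \<and> (\<forall>n. x (Suc n) = A n (x n) + y (Suc n))"
proof -
  obtain x where x: "bounded (range x)" "\<And>n. x (Suc n) = A n (x n) + P (Suc n) (y (Suc n))"
    using admissible_stable_part[OF assms] by blast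
  obtain x' where x': "bounded (range x')"
    "\<And>n. x' (Suc n) = A n (x' n) + (y (Suc n) - P (Suc n) (y (Suc n)))"
    using admissible_unstable_part[OF assms] by blast
  have "bounded (range (\<lambda>n. x n + x' n))"
    using x(1) x'(1) by (rule bounded_plus_comp)
  moreover have "x (Suc n) + x' (Suc n) = A n (x n + x' n) + y (Suc n)" for n
    unfolding x(2) x'(2) by (simp add: A_simps)
  ultimately show ?thesis by blast
qed

end

section \<open>Triangular systems\<close>

lemma (in vector_space) subspace_dim_eq:
  assumes "subspace R" "R \<subseteq> W" "W \<subseteq> span F" "finite F" "dim R = dim W"
  shows "R = W"
proof -
  obtain B where B: "B \<subseteq> R" "independent B" "R \<subseteq> span B" "card B = dim R"
    by (rule basis_exists)
  obtain C where C: "B \<subseteq> C" "C \<subseteq> W" "independent C" "W \<subseteq> span C"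
    using maximal_independent_subset_extend[of B W] B assms(2) by blast
  have "finite C"
    using independent_span_bound[OF assms(4) C(3)] C(2) assms(3) by blast
  moreover have "card C = dim W"
    using basis_card_eq_dim C by blast
  ultimately have "B = C"
    using B(4) assms(5) C(1) by (metis card_subset_eq)
  then show ?thesis
    using span_minimal[OF B(1) assms(1)] C(4) assms(2) by blast
qed

lemma snd_cocycle_triangular:
  "snd (cocycle (block_triangular A11 A12 A22) m n x) = cocycle A22 m n (snd x)"
  by (induction m) (auto simp: cocycle.simps(2) block_triangular_def split: prod.split)

lemma cocycle_diagonal:
  "cocycle (block_diagonal A11 A22) m n x = (cocycle A11 m n (fst x), cocycle A22 m n (snd x))"
  by (induction m) (auto simp: cocycle.simps(2) block_diagonal_def)

lemma block_diagonal_eq_triangular: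
  fixes A11 :: "nat \<Rightarrow> 'a::monoid_add \<Rightarrow> 'a"
  shows "block_diagonal A11 A22 = block_triangular A11 (\<lambda>_ _. 0) A22"
  by (auto simp: block_diagonal_def block_triangular_def)

lemma bounded_pairs_iff:
  "bounded (range (\<lambda>n. (f n, g n))) \<longleftrightarrow> bounded (range f) \<and> bounded (range g)"
proof
  assume "bounded (range (\<lambda>n. (f n, g n)))"
  then have "bounded (fst ` range (\<lambda>n. (f n, g n)))" "bounded (snd ` range (\<lambda>n. (f n, g n)))"
    by (rule bounded_fst, rule bounded_snd)
  then show "bounded (range f) \<and> bounded (range g)"
    by (simp add: image_image)
next
  assume "bounded (range f) \<and> bounded (range g)"
  then have "bounded (range f \<times> range g)"
    by (simp add: bounded_Times)
  then show "bounded (range (\<lambda>n. (f n, g n)))"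
    by (rule bounded_subset) auto
qed

lemma bounded_initial_values_diagonal:
  "bounded_initial_values (block_diagonal A11 A22) = bounded_initial_values A11 \<times> bounded_initial_values A22"
proof -
  have iff: "v \<in> bounded_initial_values A \<longleftrightarrow> bounded (range (\<lambda>n. cocycle A n 0 v))"
    for A :: "nat \<Rightarrow> 'c::real_normed_vector \<Rightarrow> 'c" and v
    by (auto simp: bounded_initial_values_def bdd_above_def bounded_iff)
  show ?thesis
    by (auto simp: iff cocycle_diagonal bounded_pairs_iff)
qed

locale triangular_system = h1: hilbert_space s1 + h2: hilbert_space s2
  for s1 :: "'k::{real_normed_field, euclidean_space} \<Rightarrow> 'a::{real_inner, complete_space} \<Rightarrow> 'a"
    and s2 :: "'k \<Rightarrow> 'b::{real_inner, complete_space} \<Rightarrow> 'b" +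
  fixes A11 :: "nat \<Rightarrow> 'a \<Rightarrow> 'a" and A12 :: "nat \<Rightarrow> 'b \<Rightarrow> 'a" and A22 :: "nat \<Rightarrow> 'b \<Rightarrow> 'b"
  assumes A11: "\<And>n. A11 n \<in> bounded_operators s1 s1"
    and A12: "\<And>n. A12 n \<in> bounded_operators s2 s1"
    and A22: "\<And>n. A22 n \<in> bounded_operators s2 s2"
begin

sublocale prod: vector_space_prod s1 s2 ..

abbreviation sp :: "'k \<Rightarrow> 'a \<times> 'b \<Rightarrow> 'a \<times> 'b" where "sp \<equiv> module_prod.scale s1 s2"

abbreviation T :: "nat \<Rightarrow> 'a \<times> 'b \<Rightarrow> 'a \<times> 'b" where "T \<equiv> block_triangular A11 A12 A22"

abbreviation D :: "nat \<Rightarrow> 'a \<times> 'b \<Rightarrow> 'a \<times> 'b" where "D \<equiv> block_diagonal A11 A22"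

lemma hilbert_space_sp: "hilbert_space sp"
  by (rule hilbert_space_prod) unfold_locales

lemma bounded_linear_blocks: "bounded_linear (A11 n)" "bounded_linear (A12 n)" "bounded_linear (A22 n)"
  using A11 A12 A22 by (auto simp: bounded_operators_def)

lemmas A11_simps = linear_simps[OF bounded_linear_blocks(1)]
lemmas A12_simps = linear_simps[OF bounded_linear_blocks(2)]
lemmas A22_simps = linear_simps[OF bounded_linear_blocks(3)]

lemma T_bounded_operator: "T n \<in> bounded_operators sp sp"
proof -
  have eq: "T n = (\<lambda>x. (A11 n (fst x) + A12 n (snd x), A22 n (snd x)))"
    by (auto simp: block_triangular_def)
  have "bounded_linear (T n)"
    unfolding eq
    by (intro bounded_linear_Pair bounded_linear_add
        bounded_linear_compose[OF bounded_linear_blocks(1) bounded_linear_fst]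
        bounded_linear_compose[OF bounded_linear_blocks(2) bounded_linear_snd]
        bounded_linear_compose[OF bounded_linear_blocks(3) bounded_linear_snd])
  moreover have "A11 n (s1 c a) = s1 c (A11 n a)" "A12 n (s2 c b) = s1 c (A12 n b)"
    "A22 n (s2 c b) = s2 c (A22 n b)" for a b c
    using A11[of n] A12[of n] A22[of n] by (auto simp: bounded_operators_def Vector_Spaces.linear_iff)
  then have "Vector_Spaces.linear sp sp (T n)"
    unfolding Vector_Spaces.linear_iff using prod.p.vector_space_axioms
    by (auto simp: eq prod.scale_prod A11_simps A12_simps A22_simps h1.scale_right_distrib)
  ultimately show ?thesis
    by (simp add: bounded_operators_def)
qed

lemma cocycle_T_fst: "cocycle T m n (a, 0) = (cocycle A11 m n a, 0)"
  by (induction m) (auto simp: cocycle.simps(2) block_triangular_def A12_simps A22_simps)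

lemma subspace_S2: "h2.subspace (bounded_initial_values A22)"
  unfolding bounded_initial_values_eq
  by (rule subspace_bounded_orbits_of_operators[OF h2.hilbert_space_axioms A22])

end

lemma complemented_Times:
  fixes s :: "'k::{real_normed_field, euclidean_space} \<Rightarrow> 'a::{real_inner, complete_space} \<Rightarrow> 'a"
    and t :: "'k \<Rightarrow> 'b::{real_inner, complete_space} \<Rightarrow> 'b"
  assumes "vector_space s" "vector_space t" and S: "complemented s S" and T: "complemented t T"
  shows "complemented (module_prod.scale s t) (S \<times> T)"
proof -
  interpret s: vector_space s by fact
  interpret t: vector_space t by fact
  interpret st: vector_space_prod s t by unfold_locales
  obtain Y where Y: "s.subspace Y" "closed Y" "S \<inter> Y = {0}" "\<And>x. \<exists>u\<in>S. \<exists>z\<in>Y. x = u + z"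
    using S unfolding complemented_def by blast
  obtain Z where Z: "t.subspace Z" "closed Z" "T \<inter> Z = {0}" "\<And>x. \<exists>u\<in>T. \<exists>z\<in>Z. x = u + z"
    using T unfolding complemented_def by blast
  have "\<exists>u\<in>S \<times> T. \<exists>z\<in>Y \<times> Z. x = u + z" for x
  proof -
    obtain u z where "u \<in> S" "z \<in> Y" "fst x = u + z"
      using Y(4) by blast
    moreover obtain u' z' where "u' \<in> T" "z' \<in> Z" "snd x = u' + z'"
      using Z(4) by blast
    ultimately show ?thesis
      by (intro bexI[of _ "(u, u')"] bexI[of _ "(z, z')"]) (auto simp: prod_eq_iff)
  qed
  moreover have "(S \<times> T) \<inter> (Y \<times> Z) = {0}"
    using Y(3) Z(3) by (auto simp: Times_Int_Times zero_prod_def)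
  moreover have "st.p.subspace (S \<times> T)" "st.p.subspace (Y \<times> Z)"
    using S T Y(1) Z(1) by (auto simp: complemented_def intro: st.subspace_Times)
  ultimately show ?thesis
    unfolding complemented_def using closed_Times[OF Y(2) Z(2)] by blast
qed

text \<open>The finite spanning set \<open>F\<close> carries the finite dimension of the unstable
  space, which a value of \<open>dim\<close> alone would not express.\<close>

locale triangular_dichotomy = triangular_system s1 s2 A11 A12 A22 +
    d: dichotomous_system "module_prod.scale s1 s2" "block_triangular A11 A12 A22" P K \<alpha>
  for s1 :: "'k::{real_normed_field, euclidean_space} \<Rightarrow> 'a::{real_inner, complete_space} \<Rightarrow> 'a"
    and s2 :: "'k \<Rightarrow> 'b::{real_inner, complete_space} \<Rightarrow> 'b"
    and A11 A12 A22 P K \<alpha> +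
  fixes F :: "('a \<times> 'b) set"
  assumes finite_F: "finite F" and kernel_F: "kernel (P 0) \<subseteq> module.span (module_prod.scale s1 s2) F"
begin

section \<open>Unstable components of initial values\<close>

abbreviation S1 :: "'a set" where "S1 \<equiv> bounded_initial_values A11"

abbreviation S2 :: "'b set" where "S2 \<equiv> bounded_initial_values A22"

abbreviation V :: "('a \<times> 'b) set" where "V \<equiv> kernel (P 0)"

definition Q :: "'a \<times> 'b \<Rightarrow> 'a \<times> 'b" where "Q x = x - P 0 x"

definition R :: "('a \<times> 'b) set" where "R = range (\<lambda>a. Q (a, 0))"

definition W :: "('a \<times> 'b) set" where "W = Q ` {x. snd x \<in> S2}"

lemma bounded_linear_Q: "bounded_linear Q"
  unfolding Q_def[abs_def] by (intro bounded_linear_sub bounded_linear_ident d.bounded_linear_P)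

lemmas Q_simps = linear_simps[OF bounded_linear_Q]

lemma Q_scale: "Q (sp c x) = sp c (Q x)"
proof -
  interpret Vector_Spaces.linear sp sp "P 0" by (rule d.linear_P)
  show ?thesis
    by (simp add: Q_def scale prod.p.scale_right_diff_distrib)
qed

lemma linear_Q: "Vector_Spaces.linear sp sp Q"
  unfolding Vector_Spaces.linear_iff using prod.p.vector_space_axioms by (simp add: Q_simps Q_scale)

lemma linear_Q_inl: "Vector_Spaces.linear s1 sp (\<lambda>a. Q (a, 0))"
proof -
  have "Q (a + a', 0) = Q (a, 0) + Q (a', 0)" for a a'
    by (simp flip: Q_simps)
  moreover have "Q (s1 c a, 0) = sp c (Q (a, 0))" for c a
    by (simp add: prod.scale_prod flip: Q_scale)
  ultimately show ?thesis
    unfolding Vector_Spaces.linear_iff using prod.p.vector_space_axioms h1.vector_space_axioms by simp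
qed

lemma linear_Q_inr: "Vector_Spaces.linear s2 sp (\<lambda>b. Q (0, b))"
proof -
  have "Q (0, b + b') = Q (0, b) + Q (0, b')" for b b'
    by (simp flip: Q_simps)
  moreover have "Q (0, s2 c b) = sp c (Q (0, b))" for c b
    by (simp add: prod.scale_prod flip: Q_scale)
  ultimately show ?thesis
    unfolding Vector_Spaces.linear_iff using prod.p.vector_space_axioms h2.vector_space_axioms by simp
qed

lemma Q_pair: "Q (a, b) = Q (a, 0) + Q (0, b)"
  by (simp flip: Q_simps)

lemma Q_in_V: "Q x \<in> V"
  unfolding Q_def by (rule d.diff_P_in_kernel)

lemma Q_V: "v \<in> V \<Longrightarrow> Q v = v"
  unfolding Q_def by (rule d.kernel_diff_P)

lemma subspace_V: "prod.p.subspace V"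
proof -
  interpret Vector_Spaces.linear sp sp "P 0" by (rule d.linear_P)
  show ?thesis
    unfolding kernel_def by (rule subspace_kernel)
qed

lemma bounded_initial_values_T: "bounded_initial_values T = {x. Q x = 0}"
  unfolding Q_def by (rule d.bounded_initial_values_dichotomous)

lemma S1_eq: "S1 = {a. Q (a, 0) = 0}"
proof -
  have "a \<in> S1 \<longleftrightarrow> (a, 0) \<in> bounded_initial_values T" for a
    by (simp add: bounded_initial_values_def cocycle_T_fst norm_Pair)
  then show ?thesis
    by (auto simp: bounded_initial_values_T)
qed

lemma snd_bounded_initial_value:
  assumes "x \<in> bounded_initial_values T"
  shows "snd x \<in> S2"
proof -
  obtain M where M: "\<And>n. norm (cocycle T n 0 x) \<le> M"
    using assms by (auto simp: bounded_initial_values_def bdd_above_def)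
  have "norm (cocycle A22 n 0 (snd x)) \<le> M" for n
  proof -
    have "norm (cocycle A22 n 0 (snd x)) \<le> norm (cocycle T n 0 x)"
      by (metis norm_snd_le prod.collapse snd_cocycle_triangular)
    then show ?thesis
      using M by (rule order_trans)
  qed
  then show ?thesis
    by (auto simp: bounded_initial_values_def bdd_above_def)
qed

text \<open>\<open>Q (0, b) = Q (a, 0)\<close> says that \<open>(- a, b)\<close> is in the kernel of
  \<open>Q\<close>. Lifting \<open>b\<close> to a bounded orbit thus becomes membership in a closed
  subspace.\<close>

lemma Q_in_R_iff: "Q (0, b) \<in> R \<longleftrightarrow> (\<exists>a. (a, b) \<in> bounded_initial_values T)"
proof
  assume "Q (0, b) \<in> R"
  then obtain a where "Q (0, b) = Q (a, 0)"
    by (auto simp: R_def)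
  then have "Q (- a, b) = 0"
    using Q_simps(2)[of "(0, b)" "(a, 0)"] by simp
  then show "\<exists>a. (a, b) \<in> bounded_initial_values T"
    by (auto simp: bounded_initial_values_T)
next
  assume "\<exists>a. (a, b) \<in> bounded_initial_values T"
  then obtain a where "Q (a, b) = 0"
    by (auto simp: bounded_initial_values_T)
  then have "Q (0, b) = Q (- a, 0)"
    using Q_simps(2)[of "(a, b)" "(a, 0)"] Q_simps(4)[of "(a, 0)"] by simp
  then show "Q (0, b) \<in> R"
    by (auto simp: R_def)
qed

lemma subspace_R: "prod.p.subspace R"
proof -
  interpret Vector_Spaces.linear s1 sp "\<lambda>a. Q (a, 0)" by (rule linear_Q_inl)
  show ?thesis
    unfolding R_def using h1.subspace_UNIV by (rule subspace_image)
qed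

lemma subspace_W: "prod.p.subspace W"
proof -
  interpret Vector_Spaces.linear sp sp Q by (rule linear_Q)
  have "{x :: 'a \<times> 'b. snd x \<in> S2} = UNIV \<times> S2" by auto
  then have "prod.p.subspace {x. snd x \<in> S2}"
    using prod.subspace_Times[OF h1.subspace_UNIV subspace_S2] by (simp only:)
  then show ?thesis
    unfolding W_def by (rule subspace_image)
qed

lemma R_subset_W: "R \<subseteq> W"
  using h2.subspace_0[OF subspace_S2] by (auto simp: R_def W_def)

lemma W_subset_V: "W \<subseteq> V"
  using Q_in_V by (auto simp: W_def)

text \<open>Passing to the image under \<open>Q\<close> forgets only bounded initial values of the
  triangular system, and their second components already lie in \<open>S2\<close>.\<close>

lemma Q_in_W_iff: "Q x \<in> W \<longleftrightarrow> snd x \<in> S2"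
proof
  assume "Q x \<in> W"
  then obtain y where y: "snd y \<in> S2" "Q x = Q y"
    by (auto simp: W_def)
  then have "x - y \<in> bounded_initial_values T"
    by (simp add: bounded_initial_values_T Q_simps)
  from h2.subspace_add[OF subspace_S2 snd_bounded_initial_value[OF this] y(1)]
  show "snd x \<in> S2" by simp
qed (auto simp: W_def)

lemma closed_R: "closed R" and closed_W: "closed W"
proof -
  have "W \<subseteq> prod.p.span F"
    using W_subset_V kernel_F by blast
  then show "closed R" "closed W"
    using hilbert_space.closed_subspace_finite_dim[OF hilbert_space_sp _ _ finite_F]
      subspace_R subspace_W R_subset_W by (meson order_trans)+
qed

lemma continuous_Q: "continuous_on UNIV (\<lambda>a. Q (a, 0))" "continuous_on UNIV (\<lambda>b. Q (0, b))"
  by (intro bounded_linear.continuous_on[OF bounded_linear_Q] continuous_intros)+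

lemma closed_S1: "closed S1"
proof -
  have "closed ((\<lambda>a. Q (a, 0)) -` {0})"
    by (intro closed_vimage closed_singleton continuous_Q)
  then show ?thesis
    by (simp add: S1_eq vimage_def)
qed

lemma closed_S2: "closed S2"
proof -
  have "closed ((\<lambda>b. Q (0, b)) -` W)"
    by (intro closed_vimage closed_W continuous_Q)
  then show ?thesis
    by (simp add: vimage_def Q_in_W_iff)
qed

lemma complemented_S1: "complemented s1 S1"
  and codim_S1: "codim s1 S1 = enat (prod.p.dim R)"
proof -
  interpret pair: vector_space_pair s1 sp by unfold_locales
  have fin: "range (\<lambda>a. Q (a, 0)) \<subseteq> prod.p.span F"
    using Q_in_V kernel_F by blast
  show "complemented s1 S1"
    unfolding S1_eq
    by (rule complemented_kernel[OF h1.hilbert_space_axioms hilbert_space_sp linear_Q_inl fin finite_F])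
  show "codim s1 S1 = enat (prod.p.dim R)"
    unfolding S1_eq R_def by (rule pair.codim_kernel[OF linear_Q_inl fin finite_F])
qed

text \<open>A linear map that collapses \<open>W\<close> inside \<open>V\<close> turns \<open>b \<mapsto> Q (0, b)\<close> into a map
  with kernel \<open>S2\<close>.\<close>

lemma complemented_S2: "complemented s2 S2"
  and codim_S2: "codim s2 S2 + enat (prod.p.dim W) = enat (prod.p.dim V)"
proof -
  interpret pair: vector_space_pair s2 sp by unfold_locales
  obtain h where h: "Vector_Spaces.linear sp sp h" "\<And>v. v \<in> V \<Longrightarrow> h v = 0 \<longleftrightarrow> v \<in> W"
    "prod.p.dim (h ` V) + prod.p.dim W = prod.p.dim V"
    by (rule prod.p.linear_collapse_subspace[OF subspace_W W_subset_V subspace_V kernel_F finite_F]) blast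
  interpret h: Vector_Spaces.linear sp sp h by (rule h(1))
  define g where "g b = h (Q (0, b))" for b
  have lin: "Vector_Spaces.linear s2 sp g"
    unfolding g_def using Vector_Spaces.linear_compose[OF linear_Q_inr h(1)] by (simp add: o_def)
  have S2_eq: "S2 = {b. g b = 0}"
    unfolding g_def using h(2)[OF Q_in_V] Q_in_W_iff by auto
  have range_g: "range g = h ` V"
  proof
    show "range g \<subseteq> h ` V"
      using Q_in_V by (auto simp: g_def)
    show "h ` V \<subseteq> range g"
    proof
      fix u assume "u \<in> h ` V"
      then obtain v where v: "v \<in> V" "u = h v" by blast
      \<comment> \<open>The first component contributes a vector of \<open>R\<close>, hence of
        \<open>W\<close>, which \<open>h\<close> kills; so second components alone reach all of
        \<open>h v\<close>.\<close>
      have "h (Q (fst v, 0)) = 0"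
        using h(2)[OF Q_in_V] R_subset_W by (auto simp: R_def)
      then have "u = g (snd v)"
        using v Q_V[OF v(1)] Q_pair[of "fst v" "snd v"] by (simp add: g_def flip: h.add) (metis add_0 h.add)
      then show "u \<in> range g" by blast
    qed
  qed
  have fin: "range g \<subseteq> prod.p.span (h ` F)" "finite (h ` F)"
    using kernel_F finite_F by (auto simp: range_g h.span_image)
  show "complemented s2 S2"
    unfolding S2_eq
    by (rule complemented_kernel[OF h2.hilbert_space_axioms hilbert_space_sp lin fin])
  have "codim s2 S2 = enat (prod.p.dim (range g))"
    unfolding S2_eq by (rule pair.codim_kernel[OF lin fin])
  then show "codim s2 S2 + enat (prod.p.dim W) = enat (prod.p.dim V)"
    using h(3) by (simp add: range_g)
qed

text \<open>Cancelling the finite codimension of \<open>S2\<close> leaves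
  \<open>dim R = dim W\<close>, which for \<open>R \<subseteq> W\<close> in finite dimension means
  equality. As \<open>Q (a, 0)\<close> is always in \<open>R\<close>, only the vectors
  \<open>Q (0, b)\<close> have to be tested.\<close>

lemma codim_sum_iff:
  "enat (prod.p.dim V) = codim s1 S1 + codim s2 S2 \<longleftrightarrow> (\<forall>b\<in>S2. \<exists>a. (a, b) \<in> bounded_initial_values T)"
proof -
  obtain k where k: "codim s2 S2 = enat k" "k + prod.p.dim W = prod.p.dim V"
    using codim_S2 by (cases "codim s2 S2") auto
  have "enat (prod.p.dim V) = codim s1 S1 + codim s2 S2 \<longleftrightarrow> prod.p.dim R = prod.p.dim W"
    using k by (auto simp: codim_S1)
  also have "\<dots> \<longleftrightarrow> W \<subseteq> R"
  proof
    have "W \<subseteq> prod.p.span F"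
      using W_subset_V kernel_F by blast
    then show "W \<subseteq> R" if "prod.p.dim R = prod.p.dim W"
      using prod.p.subspace_dim_eq[OF subspace_R R_subset_W _ finite_F that] by blast
    show "prod.p.dim R = prod.p.dim W" if "W \<subseteq> R"
      using that R_subset_W by (metis subset_antisym)
  qed
  also have "\<dots> \<longleftrightarrow> (\<forall>b\<in>S2. Q (0, b) \<in> R)"
  proof
    show "\<forall>b\<in>S2. Q (0, b) \<in> R" if "W \<subseteq> R"
      using that Q_in_W_iff by fastforce
    assume *: "\<forall>b\<in>S2. Q (0, b) \<in> R"
    have "Q (a, b) \<in> R" if "b \<in> S2" for a b
      using prod.p.subspace_add[OF subspace_R, of "Q (a, 0)" "Q (0, b)"] * that
      by (subst Q_pair) (auto simp: R_def)
    then show "W \<subseteq> R"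
      by (auto simp: W_def)
  qed
  finally show ?thesis
    by (simp add: Q_in_R_iff)
qed

text \<open>The perturbation \<open>(y, 0)\<close> is solved in the triangular system. The second
  component of the solution is an unperturbed bounded orbit of \<open>A22\<close>, so it starts in
  \<open>S2\<close>. Subtracting a bounded triangular orbit with the same second component removes
  the coupling through \<open>A12\<close>.\<close>

lemma admissible_A11:
  assumes lift: "\<And>b. b \<in> S2 \<Longrightarrow> \<exists>a. (a, b) \<in> bounded_initial_values T"
    and y: "bounded (range y)"
  shows "\<exists>x. bounded (range x) \<and> (\<forall>n. x (Suc n) = A11 n (x n) + y (Suc n))"
proof -
  have "bounded (range (\<lambda>n. (y n, 0 :: 'b)))"
    using y by (simp add: bounded_pairs_iff image_constant_conv)
  from d.admissible[OF this] obtain x where x: "bounded (range x)"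
    "\<And>n. x (Suc n) = T n (x n) + (y (Suc n), 0)" by blast
  have "snd (x (Suc n)) = A22 n (snd (x n))" for n
    by (simp add: x(2) block_triangular_def split: prod.split)
  then have x_snd: "snd (x n) = cocycle A22 n 0 (snd (x 0))" for n
    by (intro cocycle_unique[where x = "\<lambda>n. snd (x n)"]) auto
  have "bounded (range (\<lambda>n. snd (x n)))"
    using bounded_snd[OF x(1)] by (simp add: image_image)
  then have "snd (x 0) \<in> S2"
    by (auto simp: bounded_initial_values_def bdd_above_def bounded_iff simp flip: x_snd)
  then obtain a where a: "(a, snd (x 0)) \<in> bounded_initial_values T"
    using lift by blast
  define z where "z n = cocycle T n 0 (a, snd (x 0))" for n
  have z_snd: "snd (z n) = snd (x n)" for n
    using x_snd[of n] by (simp add: z_def snd_cocycle_triangular)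
  have "bounded (range z)"
    using a unfolding z_def by (auto simp: bounded_initial_values_def bdd_above_def bounded_iff)
  then have "bounded (range (\<lambda>n. fst (x n) - fst (z n)))"
    using bounded_fst[OF x(1)] bounded_fst[of "range z"]
    by (intro bounded_minus_comp) (simp_all add: image_image)
  moreover have "fst (x (Suc n)) - fst (z (Suc n)) = A11 n (fst (x n) - fst (z n)) + y (Suc n)" for n
  proof -
    have "fst (x (Suc n)) = A11 n (fst (x n)) + A12 n (snd (x n)) + y (Suc n)"
      by (simp add: x(2) block_triangular_def split: prod.split)
    moreover have "fst (z (Suc n)) = A11 n (fst (z n)) + A12 n (snd (z n))"
      by (simp add: z_def cocycle_Suc) (simp add: block_triangular_def split: prod.split)
    ultimately show ?thesis
      by (simp add: z_snd A11_simps)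
  qed
  ultimately show ?thesis
    by (intro exI[of _ "\<lambda>n. fst (x n) - fst (z n)"]) simp
qed

lemma admissible_A22:
  assumes "bounded (range y)"
  shows "\<exists>x. bounded (range x) \<and> (\<forall>n. x (Suc n) = A22 n (x n) + y (Suc n))"
proof -
  have "bounded (range (\<lambda>n. (0 :: 'a, y n)))"
    using assms by (simp add: bounded_pairs_iff image_constant_conv)
  from d.admissible[OF this] obtain x where x: "bounded (range x)"
    "\<And>n. x (Suc n) = T n (x n) + (0, y (Suc n))" by blast
  have "bounded (range (\<lambda>n. snd (x n)))"
    using bounded_snd[OF x(1)] by (simp add: image_image)
  moreover have "snd (x (Suc n)) = A22 n (snd (x n)) + y (Suc n)" for n
    by (simp add: x(2) block_triangular_def split: prod.split)
  ultimately show ?thesis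
    by (intro exI[of _ "\<lambda>n. snd (x n)"]) simp
qed

lemma exp_dichotomy_A22: "exp_dichotomy s2 A22"
  by (rule exp_dichotomy_if_admissible[OF h2.hilbert_space_axioms A22 complemented_S2 admissible_A22])

lemma D_bounded_operator: "D n \<in> bounded_operators sp sp"
proof -
  have "(\<lambda>_. 0) \<in> bounded_operators s2 s1"
    using h1.vector_space_axioms h2.vector_space_axioms
    by (simp add: bounded_operators_def Vector_Spaces.linear_iff)
  then interpret zero: triangular_system s1 s2 A11 "\<lambda>_ _. 0" A22
    using A11 A22 by unfold_locales
  show ?thesis
    unfolding block_diagonal_eq_triangular by (rule zero.T_bounded_operator)
qed

lemma exp_dichotomy_D_if_lift:
  assumes lift: "\<And>b. b \<in> S2 \<Longrightarrow> \<exists>a. (a, b) \<in> bounded_initial_values T"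
  shows "exp_dichotomy sp D"
proof (rule exp_dichotomy_if_admissible[OF hilbert_space_sp D_bounded_operator])
  show "complemented sp (bounded_initial_values D)"
    unfolding bounded_initial_values_diagonal
    by (rule complemented_Times[OF h1.vector_space_axioms h2.vector_space_axioms complemented_S1 complemented_S2])
  fix y :: "nat \<Rightarrow> 'a \<times> 'b" assume "bounded (range y)"
  then have "bounded (range (\<lambda>n. fst (y n)))" "bounded (range (\<lambda>n. snd (y n)))"
    using bounded_pairs_iff[of "\<lambda>n. fst (y n)" "\<lambda>n. snd (y n)"] by simp_all
  then obtain x x' where x: "bounded (range x)" "\<And>n. x (Suc n) = A11 n (x n) + fst (y (Suc n))"
    and x': "bounded (range x')" "\<And>n. x' (Suc n) = A22 n (x' n) + snd (y (Suc n))"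
    using admissible_A11[OF lift] admissible_A22 by metis
  then show "\<exists>x. bounded (range x) \<and> (\<forall>n. x (Suc n) = D n (x n) + y (Suc n))"
    by (intro exI[of _ "\<lambda>n. (x n, x' n)"])
      (simp add: bounded_pairs_iff block_diagonal_def prod_eq_iff)
qed

text \<open>For \<open>b \<in> S2\<close> the unstable parts of \<open>(0, \<Phi>\<^sub>2\<^sub>2(n, 0) b)\<close> stay bounded, so their
  preimages \<open>w n\<close> at time \<open>0\<close> tend to \<open>0\<close>. The dichotomy of the diagonal system yields
  \<open>X\<^sub>1 = \<Phi>\<^sub>1\<^sub>1(n, 0) X\<^sub>1 + S1(n)\<close>, which lifts \<open>b - snd (w n)\<close> to a bounded orbit at time \<open>0\<close>.\<close>

lemma lift_if_exp_dichotomy_D: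
  assumes D: "exp_dichotomy sp D" and b: "b \<in> S2"
  shows "\<exists>a. (a, b) \<in> bounded_initial_values T"
proof -
  obtain P' where "exp_dichotomy_with sp D P'"
    using D by (auto simp: exp_dichotomy_def)
  then obtain K' \<alpha>' where "dichotomous_system sp D P' K' \<alpha>'"
    by (rule exp_dichotomy_with_imp_dichotomous_system[OF hilbert_space_sp D_bounded_operator])
  then interpret diag: dichotomous_system sp D P' K' \<alpha>' .
  obtain M where M: "\<And>n. norm (cocycle A22 n 0 b) \<le> M"
    using b by (auto simp: bounded_initial_values_def bdd_above_def)
  define v where "v n = (0 :: 'a, cocycle A22 n 0 b)" for n
  define w where "w n = backward_cocycle T P 0 n (v n - P n (v n))" for n
  have w: "cocycle T n 0 (w n) = v n - P n (v n)" for n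
    unfolding w_def by (rule d.backward_cocycle_kernel) (simp_all add: d.diff_P_in_kernel)
  have w_le: "norm (w n) \<le> K * M * exp (- \<alpha> * (real n - real 0))" for n
  proof -
    have "norm (w n) \<le> K * exp (- \<alpha> * (real n - real 0)) * norm (v n)"
      unfolding w_def by (rule d.unstable) simp
    also have "\<dots> \<le> K * exp (- \<alpha> * (real n - real 0)) * M"
      using M d.K_pos by (intro mult_left_mono) (auto simp: v_def norm_Pair)
    finally show ?thesis by (simp add: ac_simps)
  qed
  have "w \<longlonglongrightarrow> 0"
    by (rule Lim_null_comparison[OF always_eventually d.exp_decay_tendsto]) (use w_le in blast)
  then have "(\<lambda>n. Q (0, b - snd (w n))) \<longlonglongrightarrow> Q (0, b - snd (0 :: 'a \<times> 'b))"
    by (intro bounded_linear.tendsto[OF bounded_linear_Q] tendsto_intros)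
  moreover have "Q (0, b - snd (w n)) \<in> R" for n
  proof -
    define e where "e = cocycle T n 0 (0, b - snd (w n))"
    \<comment> \<open>At time \<open>n\<close> the orbit \<open>e\<close> has the same second
      component as the stable vector \<open>P n (v n)\<close>; \<open>f\<close> is the remaining
      discrepancy in the first factor.\<close>
    define f where "f = fst (P n (v n)) - fst e"
    have "(f, 0) - P' n (f, 0) \<in> kernel (P' n)"
      by (rule diag.diff_P_in_kernel)
    then obtain u where u: "cocycle D n 0 u = (f, 0) - P' n (f, 0)"
      using diag.backward_cocycle_kernel(2)[of 0 n] by blast
    \<comment> \<open>\<open>P' n\<close> need not respect the two factors, so only first components
      of the splitting of \<open>(f, 0)\<close> are kept. This suffices because the diagonal and
      triangular cocycles agree on vectors with second component 0.\<close>
    define s where "s = fst (P' n (f, 0))"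
    have f_eq: "f = cocycle A11 n 0 (fst u) + s"
      using u by (simp add: cocycle_diagonal s_def prod_eq_iff algebra_simps)
    have s: "(s, 0) \<in> bounded_orbits T n"
    proof -
      obtain M' where M': "\<And>m. m \<ge> n \<Longrightarrow> norm (cocycle D m n (P' n (f, 0))) \<le> M'"
        using diag.P_in_bounded_orbits[of n "(f, 0)"] by (auto simp: bounded_orbits_def)
      have "norm (cocycle T m n (s, 0)) \<le> M'" if "m \<ge> n" for m
      proof -
        have "norm (cocycle T m n (s, 0)) = norm (fst (cocycle D m n (P' n (f, 0))))"
          by (simp add: cocycle_T_fst cocycle_diagonal s_def norm_Pair)
        also have "\<dots> \<le> norm (cocycle D m n (P' n (f, 0)))"
          by (metis norm_fst_le prod.collapse)
        finally show ?thesis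
          using M'[OF that] by simp
      qed
      then show ?thesis
        by (auto simp: bounded_orbits_def)
    qed
    have sub: "prod.p.subspace (bounded_orbits T n)"
      by (rule subspace_bounded_orbits_of_operators[OF hilbert_space_sp T_bounded_operator])
    \<comment> \<open>Starting at \<open>fst u\<close> in the first factor corrects \<open>f\<close>
      up to \<open>s\<close>, so at time \<open>n\<close> the orbit is a difference of two vectors
      with bounded orbits.\<close>
    have "cocycle T n 0 (fst u, b - snd (w n)) = cocycle T n 0 (fst u, 0) + e"
      unfolding e_def by (simp flip: d.cocycle_linear_simps)
    also have "\<dots> = P n (v n) - (s, 0)"
    proof -
      have "snd e = snd (v n - cocycle T n 0 (w n))"
        unfolding e_def
        using snd_cocycle_triangular[of A11 A12 A22 n 0 "(0, b) - w n"] snd_cocycle_triangular[of A11 A12 A22 n 0 "(0, b - snd (w n))"]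
        by (simp add: d.cocycle_linear_simps snd_cocycle_triangular v_def)
      then have "snd e = snd (P n (v n))"
        by (simp add: w)
      then show ?thesis
        using f_eq by (simp add: cocycle_T_fst prod_eq_iff f_def algebra_simps)
    qed
    also have "\<dots> \<in> bounded_orbits T n"
      by (rule prod.p.subspace_diff[OF sub d.P_in_bounded_orbits s])
    finally have "(fst u, b - snd (w n)) \<in> bounded_initial_values T"
      by (simp add: bounded_orbits_cocycle_iff bounded_initial_values_eq)
    then show ?thesis
      by (auto simp: Q_in_R_iff)
  qed
  \<comment> \<open>Since \<open>w n\<close> tends to 0, the approximate lifts pass to the limit in
    the closed subspace \<open>R\<close>.\<close>
  ultimately have "Q (0, b) \<in> R"
    using closed_sequentially[OF closed_R] by fastforce
  then show ?thesis
    by (simp add: Q_in_R_iff)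
qed

theorem exp_dichotomy_D_iff: "exp_dichotomy sp D \<longleftrightarrow> enat (prod.p.dim V) = codim s1 S1 + codim s2 S2"
  unfolding codim_sum_iff using exp_dichotomy_D_if_lift lift_if_exp_dichotomy_D by blast

end

theorem theorem7:
  fixes s1 :: "'k::{real_normed_field, euclidean_space} \<Rightarrow> 'a::{real_inner, complete_space} \<Rightarrow> 'a"
    and s2 :: "'k \<Rightarrow> 'b::{real_inner, complete_space} \<Rightarrow> 'b"
    and A11 :: "nat \<Rightarrow> 'a \<Rightarrow> 'a" and A12 :: "nat \<Rightarrow> 'b \<Rightarrow> 'a" and A22 :: "nat \<Rightarrow> 'b \<Rightarrow> 'b"
    and P :: "nat \<Rightarrow> 'a \<times> 'b \<Rightarrow> 'a \<times> 'b" and d :: nat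
    and S1 :: "'a set" and S2 :: "'b set" and d1 d2 :: enat
  assumes "hilbert_space s1" and "hilbert_space s2"
    and "\<And>n. A11 n \<in> bounded_operators s1 s1"
    and "\<And>n. A12 n \<in> bounded_operators s2 s1"
    and "\<And>n. A22 n \<in> bounded_operators s2 s2"
    and "exp_dichotomy_with (module_prod.scale s1 s2) (block_triangular A11 A12 A22) P"
    and "edim (module_prod.scale s1 s2) (kernel (P 0)) = enat d"
    and "S1 = bounded_initial_values A11" and "S2 = bounded_initial_values A22"
    and "d1 = codim s1 S1" and "d2 = codim s2 S2"
  shows "(complemented s2 S2 \<and> closed S2 \<and> d2 \<le> enat d \<and> exp_dichotomy s2 A22) \<and>
         (closed S1 \<and> complemented s1 S1) \<and>
         (exp_dichotomy (module_prod.scale s1 s2) (block_diagonal A11 A22) \<longleftrightarrow> enat d = d1 + d2)"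
proof -
  interpret h1: hilbert_space s1 by fact
  interpret h2: hilbert_space s2 by fact
  interpret triangular_system s1 s2 A11 A12 A22
    using assms(3-5) by unfold_locales
  obtain K \<alpha> where "dichotomous_system sp T P K \<alpha>"
    by (rule exp_dichotomy_with_imp_dichotomous_system[OF hilbert_space_sp T_bounded_operator assms(6)])
  then interpret d: dichotomous_system sp T P K \<alpha> .
  obtain F where F: "finite F" "kernel (P 0) \<subseteq> prod.p.span F" "prod.p.dim (kernel (P 0)) = d"
    using assms(7) by (auto simp: edim_def split: if_splits)
  interpret triangular_dichotomy s1 s2 A11 A12 A22 P K \<alpha> F
    using F by unfold_locales
  have "codim s2 (bounded_initial_values A22) \<le> enat d"
    using codim_S2 F(3) by (cases "codim s2 (bounded_initial_values A22)") auto
  then show ?thesis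
    using complemented_S2 closed_S2 exp_dichotomy_A22 closed_S1 complemented_S1 exp_dichotomy_D_iff
    unfolding assms(8-11) F(3) by blast
qed

end
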